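(* Let $\{\mathcal{T}(t)\}_{t\ge 0}$ be the symmetric telegraph process with speed $c>0$ and rate $\lambda>0$, and let $t>0$. For every integer $k\ge 0$ and $0<\beta<ct$, $$P\Bigl\{ \max_{0\le s\le t} \mathcal{T}(s) \in d\beta \,\Big|\, V(0) = -c,\ N(t) = 2k+1\Bigr\} = \Biggl( \frac{(2k+1)!}{(k-1)!(k+1)!}\, \frac{(c^2t^2 - \beta^2)^{k-1}(ct-\beta)}{(2ct)^{2k}} +\frac{(2k+1)!}{k!(k+1)!}\, \frac{(c^2t^2 - \beta^2)^{k}}{(2ct)^{2k+1}} \Biggr)d\beta ,$$ where for $k=0$ the first summand is understood to be $0$ (convention $1/(-1)!=0$), and $$P\Bigl\{ \max_{0\le s\le t} \mathcal{T}(s) = 0 \,\Big|\, V(0) = -c,\ N(t) = 2k+1\Bigr\} = \binom{2k+1}{k}\frac{1}{2^{2k+1}} .$$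
   Context: Let $c>0$, $\lambda>0$. Let $V(0)$ be a random variable with $P\{V(0)=c\}=P\{V(0)=-c\}=\tfrac12$ and let $\{N(t)\}_{t\ge0}$ be a homogeneous Poisson process with rate $\lambda$, independent of $V(0)$. The symmetric telegraph process is $\mathcal{T}(t)=\int_0^t V(0)(-1)^{N(s)}\,ds$, $t\ge 0$ (so $\mathcal{T}(0)=0$). A formula $P\{X\in d\beta\mid A\}=f(\beta)\,d\beta$ for $0<\beta<ct$ means that the conditional law of $X$ given the event $A$, restricted to the open interval $(0,ct)$, is absolutely continuous with density $f$. *)

theory Defs
  imports "HOL-Probability.Probability"
begin

text \<open>
  The path conditions are imposed on all of \<^term>\<open>space M\<close>, so that \<^term>\<open>M\<close> need not be
  complete for path functionals such as the running maximum to be measurable.  Only times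
  \<open>t \<ge> 0\<close> matter.  Since paths are nondecreasing, truncated subtraction on \<^typ>\<open>nat\<close> gives the
  true increments.
\<close>

locale poisson_process = prob_space M for M :: "'a measure" +
  fixes rate :: real and N :: "real \<Rightarrow> 'a \<Rightarrow> nat"
  assumes rate_pos: "rate > 0"
    and random_variable_N: "\<And>t. t \<ge> 0 \<Longrightarrow> N t \<in> measurable M (count_space UNIV)"
    and N_zero: "\<And>\<omega>. \<omega> \<in> space M \<Longrightarrow> N 0 \<omega> = 0"
    and N_mono: "\<And>\<omega>. \<omega> \<in> space M \<Longrightarrow> mono_on {0..} (\<lambda>t. N t \<omega>)"
    and N_right_continuous:
      "\<And>\<omega> t. \<omega> \<in> space M \<Longrightarrow> t \<ge> 0 \<Longrightarrow> continuous (at_right t) (\<lambda>s. N s \<omega>)"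
    and independent_increments:
      "\<And>(n::nat) \<tau>. 0 \<le> \<tau> 0 \<Longrightarrow> (\<And>i. i < n \<Longrightarrow> \<tau> i \<le> \<tau> (Suc i)) \<Longrightarrow>
         indep_vars (\<lambda>_. count_space UNIV) (\<lambda>i \<omega>. N (\<tau> (Suc i)) \<omega> - N (\<tau> i) \<omega>) {..<n}"
    and poisson_increments:
      "\<And>s t. 0 \<le> s \<Longrightarrow> s < t \<Longrightarrow>
         distr M (count_space UNIV) (\<lambda>\<omega>. N t \<omega> - N s \<omega>)
           = measure_pmf (poisson_pmf (rate * (t - s)))"

text \<open>
  The initial velocity is independent of the whole process \<open>N\<close>, that is, of the sigma-algebra
  generated by all \<open>N t\<close> with \<open>t \<ge> 0\<close>.
\<close>

locale symmetric_telegraph = poisson_process M rate N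
  for M :: "'a measure" and rate :: real and N :: "real \<Rightarrow> 'a \<Rightarrow> nat" +
  fixes c :: real and V0 :: "'a \<Rightarrow> real"
  assumes speed_pos: "c > 0"
    and random_variable_V0: "V0 \<in> borel_measurable M"
    and prob_V0_pos: "\<P>(\<omega> in M. V0 \<omega> = c) = 1 / 2"
    and prob_V0_neg: "\<P>(\<omega> in M. V0 \<omega> = - c) = 1 / 2"
    and V0_indep_N:
      "indep_set {V0 -` B \<inter> space M | B. B \<in> sets borel}
         (sigma_sets (space M) {N t -` B \<inter> space M | t B. t \<ge> 0})"

definition telegraph :: "('a \<Rightarrow> real) \<Rightarrow> (real \<Rightarrow> 'a \<Rightarrow> nat) \<Rightarrow> real \<Rightarrow> 'a \<Rightarrow> real" where
  "telegraph V0 N t \<omega> = integral {0..t} (\<lambda>s. V0 \<omega> * (- 1) ^ N s \<omega>)"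

text \<open>
  A supremum, because \<^const>\<open>Max\<close> is only meaningful for finite sets.  Lemma
  \<open>running_max_attained\<close> below shows that it is a maximum.
\<close>

definition running_max :: "(real \<Rightarrow> 'a \<Rightarrow> real) \<Rightarrow> real \<Rightarrow> 'a \<Rightarrow> real" where
  "running_max X t \<omega> = (SUP s\<in>{0..t}. X s \<omega>)"

text \<open>
  The conditional law of \<open>X\<close> given the event \<open>A\<close>, restricted to \<open>S\<close>, is absolutely continuous
  with density \<open>f\<close>; \<^term>\<open>uniform_measure M A\<close> is the conditional probability given \<open>A\<close>.
\<close>

definition cond_density_on ::
  "'a measure \<Rightarrow> 'a set \<Rightarrow> ('a \<Rightarrow> real) \<Rightarrow> real set \<Rightarrow> (real \<Rightarrow> real) \<Rightarrow> bool" where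
  "cond_density_on M A X S f \<longleftrightarrow>
     A \<in> sets M \<and> emeasure M A \<noteq> 0 \<and> X \<in> borel_measurable M \<and>
     f \<in> borel_measurable (restrict_space lborel S) \<and> (\<forall>\<beta>\<in>S. 0 \<le> f \<beta>) \<and>
     restrict_space (distr (uniform_measure M A) borel X) S
       = density (restrict_space lborel S) (\<lambda>\<beta>. ennreal (f \<beta>))"

lemma (in symmetric_telegraph) velocity_integrable:
  assumes \<omega>: "\<omega> \<in> space M"
  shows "(\<lambda>s. V0 \<omega> * (- 1) ^ N s \<omega>) integrable_on {0..t}"
proof -
  define g where "g = (\<lambda>s. N (max 0 s) \<omega>)"
  have "mono (\<lambda>s. real (g s))"
    using N_mono[OF \<omega>] by (auto simp: g_def mono_def mono_on_def)
  then have m1: "(\<lambda>s. real (g s)) \<in> borel_measurable borel"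
    by (rule borel_measurable_mono)
  have m2: "(\<lambda>s. (- 1 :: real) ^ nat \<lfloor>real (g s)\<rfloor>) \<in> borel_measurable borel"
    using m1 by measurable
  have "set_integrable lborel {0..t} (\<lambda>s. V0 \<omega> * (- 1) ^ g s)"
    unfolding set_integrable_def
  proof (rule integrableI_bounded_set_indicator[where B = "\<bar>V0 \<omega>\<bar>"])
    show "(\<lambda>s. V0 \<omega> * (- 1) ^ g s) \<in> borel_measurable lborel"
      using m2 by simp
  qed (auto simp: abs_mult power_abs emeasure_lborel_Icc_eq)
  then have "(\<lambda>s. V0 \<omega> * (- 1) ^ g s) integrable_on {0..t}"
    by (rule set_borel_integral_eq_integral)
  then show ?thesis
    by (rule integrable_eq) (auto simp: g_def)
qed

lemma (in symmetric_telegraph) running_max_attained: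
  assumes \<omega>: "\<omega> \<in> space M" and t: "t \<ge> 0"
  shows "\<exists>s\<in>{0..t}. running_max (telegraph V0 N) t \<omega> = telegraph V0 N s \<omega> \<and>
           (\<forall>u\<in>{0..t}. telegraph V0 N u \<omega> \<le> telegraph V0 N s \<omega>)"
proof -
  have "continuous_on {0..t} (\<lambda>s. telegraph V0 N s \<omega>)"
    unfolding telegraph_def
    by (rule indefinite_integral_continuous_1) (rule velocity_integrable[OF \<omega>])
  then obtain s where s: "s \<in> {0..t}" "\<forall>u\<in>{0..t}. telegraph V0 N u \<omega> \<le> telegraph V0 N s \<omega>"
    using continuous_attains_sup[of "{0..t}" "\<lambda>s. telegraph V0 N s \<omega>"] t by auto
  then have "running_max (telegraph V0 N) t \<omega> = telegraph V0 N s \<omega>"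
    unfolding running_max_def by (intro cSup_eq_maximum) auto
  with s show ?thesis by blast
qed

end

theory Submission
  imports Defs
begin

text \<open>
  Cut \<open>[0,t]\<close> into \<open>m = L + 1\<close> cells and record, for each of the first \<open>L\<close> cells, whether
  \<open>N\<close> jumps in it.  Given \<open>N t = n\<close>, up to an event whose probability vanishes as \<open>L\<close> grows
  (two jumps in one cell, or a jump in the last cell), all \<open>L choose n\<close> patterns are equally likely,
  and the telegraph process stays within \<open>O(n c t / m)\<close> of a lattice walk of \<open>m\<close> steps whose turns
  are given by the pattern.  The walks with \<open>n\<close> turns that reach the level \<open>m - 2 x\<close> are counted
  by two tails of the Vandermonde sum \<open>\<Sum>i. (x choose i) * (L - x choose (n - i))\<close>, because these
  tails satisfy the first-step recursion.  Letting \<open>x / m\<close> tend to \<open>p = (1 - \<beta> / (c t)) / 2\<close> gives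
  \<open>P(max > \<beta>) = P(B \<ge> k + 1) + P(B \<ge> k + 2)\<close> with \<open>B\<close> binomial with parameters \<open>2 k + 1\<close> and
  \<open>p\<close>.  Minus its derivative in \<open>\<beta>\<close> is the density, and its defect from 1 at \<open>\<beta> = 0\<close> is the atom.
\<close>

section \<open>Lattice walks with a given number of turns\<close>

definition binom_tail :: "nat \<Rightarrow> nat \<Rightarrow> nat \<Rightarrow> nat \<Rightarrow> nat" where
  "binom_tail j n x y = (\<Sum>i=j..n. (x choose i) * (y choose (n - i)))"

text \<open>Pascal's rule in \<open>x\<close> also lowers the starting index of the tail. This is
  the recursion for a downward first step, while \<open>binom_tail_Suc_right\<close>, which keeps
  the start, serves an upward one.\<close>

lemma binom_tail_Suc_left:
  "binom_tail (Suc j) (Suc n) (Suc x) y = binom_tail (Suc j) (Suc n) x y + binom_tail j n x y"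
proof -
  have "binom_tail (Suc j) (Suc n) z y = (\<Sum>i=j..n. (z choose Suc i) * (y choose (n - i)))" for z
    unfolding binom_tail_def by (subst sum.shift_bounds_cl_Suc_ivl) simp
  then show ?thesis
    by (simp add: binom_tail_def sum.distrib[symmetric] algebra_simps)
qed

lemma binom_tail_Suc_right:
  "binom_tail j (Suc n) x (Suc y) = binom_tail j (Suc n) x y + binom_tail j n x y"
proof (cases "j \<le> Suc n")
  case True
  have "(\<Sum>i=j..n. (x choose i) * (Suc y choose (Suc n - i)))
      = (\<Sum>i=j..n. (x choose i) * (y choose (Suc n - i)) + (x choose i) * (y choose (n - i)))"
    by (intro sum.cong) (auto simp: Suc_diff_le algebra_simps)
  with True show ?thesis
    by (simp add: binom_tail_def sum.distrib)
qed (simp add: binom_tail_def)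

lemma binom_tail_zero_right: "binom_tail j 0 x y = (if j = 0 then 1 else 0)"
  by (simp add: binom_tail_def)

lemma binom_tail_zero_left: "binom_tail (Suc j) n 0 y = 0"
  by (simp add: binom_tail_def)

text \<open>For \<open>x = y\<close> the reflection of \<open>i\<close> to \<open>n - i\<close>
  turns the second tail into the part of the Vandermonde sum that the first one omits.\<close>

lemma binom_tail_symmetric:
  "binom_tail (Suc n div 2) n x x + binom_tail (Suc (n div 2)) n x x = (2 * x) choose n"
proof -
  let ?f = "\<lambda>i. (x choose i) * (x choose (n - i))"
  have *: "binom_tail (Suc (n div 2)) n x x = sum ?f {..<Suc n div 2}"
    unfolding binom_tail_def
    by (rule sum.reindex_bij_witness[of _ "\<lambda>i. n - i" "\<lambda>i. n - i"]) (auto simp: mult.commute)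
  have "{..n} = {Suc n div 2..n} \<union> {..<Suc n div 2}" by auto
  then have "sum ?f {..n} = sum ?f {Suc n div 2..n} + sum ?f {..<Suc n div 2}"
    by (simp only:) (subst sum.union_disjoint, auto)
  moreover have "sum ?f {..n} = (2 * x) choose n"
    using vandermonde[of x x n] by (simp add: mult_2)
  ultimately show ?thesis
    unfolding * by (simp add: binom_tail_def)
qed

text \<open>A walk with unit steps starts in direction \<open>v\<close> and turns after step \<open>i + 1\<close> iff \<open>e ! i\<close>.\<close>

definition reaches :: "int \<Rightarrow> int \<Rightarrow> bool list \<Rightarrow> bool" where
  "reaches v b e \<longleftrightarrow> (\<exists>j\<le>length e. b \<le> (\<Sum>i\<le>j. v * (- 1) ^ count_list (take i e) True))"

definition turning_paths :: "int \<Rightarrow> int \<Rightarrow> nat \<Rightarrow> nat \<Rightarrow> bool list set" where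
  "turning_paths v b n L = {e. length e = L \<and> count_list e True = n \<and> reaches v b e}"

lemma ex_le_Suc_conv: "(\<exists>j\<le>Suc n. P j) \<longleftrightarrow> P 0 \<or> (\<exists>j\<le>n. P (Suc j))"
  by (metis Suc_le_mono le0 not0_implies_Suc)

text \<open>Either the first step already attains \<open>b\<close>, or the rest of the walk must
  gain the remaining \<open>b - v\<close>, starting in the direction that the first entry
  dictates.\<close>

lemma reaches_Cons:
  "reaches v b (a # e) \<longleftrightarrow> b \<le> v \<or> reaches (if a then - v else v) (b - v) e"
  unfolding reaches_def length_Cons ex_le_Suc_conv
  by (auto simp: sum.atMost_Suc_shift sum_negf algebra_simps simp del: sum.atMost_Suc)

lemma reaches_first: "b \<le> v \<Longrightarrow> reaches v b e"
  unfolding reaches_def by (rule exI[of _ 0]) simp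

lemma not_reaches:
  assumes "v + int (length e) < b" "\<bar>v\<bar> \<le> 1"
  shows "\<not> reaches v b e"
proof -
  have "(\<Sum>i\<le>j. v * (- 1) ^ count_list (take i e) True) \<le> v + int j" for j
  proof (induction j)
    case (Suc j)
    have "v * (- 1) ^ m \<le> 1" for m :: nat
      using assms(2) by (cases "even m") auto
    from add_mono[OF Suc this[of "count_list (take (Suc j) e) True"]] show ?case by simp
  qed simp
  then show ?thesis
    using assms(1) unfolding reaches_def by (smt (verit) of_nat_mono)
qed

lemma finite_bool_lists [simp]: "finite {e :: bool list. length e = L \<and> P e}"
  by (rule finite_subset[OF _ finite_lists_length_eq[of UNIV L]]) auto

lemma card_split_Cons:
  "card {e :: bool list. length e = Suc L \<and> P e}
     = card {e. length e = L \<and> P (False # e)} + card {e. length e = L \<and> P (True # e)}"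
proof -
  have "{e :: bool list. length e = Suc L \<and> P e}
      = (#) False ` {e. length e = L \<and> P (False # e)} \<union> (#) True ` {e. length e = L \<and> P (True # e)}"
    by (auto simp: length_Suc_conv image_iff) (metis (full_types))+
  moreover have "card ((#) a ` {e. length e = L \<and> P (a # e)}) = card {e. length e = L \<and> P (a # e)}" for a
    by (rule card_image) simp
  ultimately show ?thesis
    by (simp only:) (subst card_Un_disjoint, auto)
qed

lemma card_bool_lists_count:
  "card {e. length e = L \<and> count_list e True = n} = L choose n"
proof (induction L arbitrary: n)
  case 0
  show ?case by (cases n) (auto simp: Collect_conv_if)
next
  case (Suc L)
  show ?case
    by (cases n) (simp_all add: card_split_Cons Suc)
qed

lemma turning_paths_first: "b \<le> v \<Longrightarrow> card (turning_paths v b n L) = L choose n"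
  by (simp add: turning_paths_def reaches_first card_bool_lists_count)

text \<open>First-step analysis: below \<open>b\<close> the first step alone never suffices, so the
  walks split by whether they turn after it. With no turns to spend, only one branch
  survives.\<close>

lemma turning_paths_step:
  assumes "v < b"
  shows "card (turning_paths v b 0 (Suc L)) = card (turning_paths v (b - v) 0 L)"
    and "card (turning_paths v b (Suc n) (Suc L))
           = card (turning_paths v (b - v) (Suc n) L) + card (turning_paths (- v) (b - v) n L)"
  using assms by (simp_all add: turning_paths_def card_split_Cons reaches_Cons)

lemma turning_paths_unreachable:
  "v + int L < b \<Longrightarrow> \<bar>v\<bar> \<le> 1 \<Longrightarrow> card (turning_paths v b n L) = 0"
  by (auto simp: turning_paths_def not_reaches)

text \<open>The level is the endpoint of a walk with \<open>y + 1\<close> upward and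
  \<open>x\<close> downward steps, so an upward first step lowers \<open>y\<close> and a downward
  one lowers \<open>x\<close>. Both directions are proved in one induction on the length, since a
  turn passes from one count to the other. The Pascal rules for \<open>binom_tail\<close> match the
  recursion.\<close>

lemma card_turning_paths:
  assumes "x \<le> y"
  shows "card (turning_paths 1 (1 + int y - int x) n (x + y))
           = binom_tail (Suc n div 2) n x y + binom_tail (Suc (n div 2)) n x y"
    and "card (turning_paths (- 1) (1 + int y - int x) n (x + y))
           = binom_tail (Suc (n div 2)) n x y + binom_tail (Suc (Suc n div 2)) n x y"
proof -
  have "x \<le> y \<longrightarrow> x + y = L \<longrightarrow> (\<forall>n.
      card (turning_paths 1 (1 + int y - int x) n L)
        = binom_tail (Suc n div 2) n x y + binom_tail (Suc (n div 2)) n x y \<and>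
      card (turning_paths (- 1) (1 + int y - int x) n L)
        = binom_tail (Suc (n div 2)) n x y + binom_tail (Suc (Suc n div 2)) n x y)" for L
  proof (induction L arbitrary: x y)
    case 0
    have "0 choose n = binom_tail (Suc n div 2) n 0 0" for n
      using binom_tail_symmetric[of n 0] by (simp add: binom_tail_zero_left)
    then show ?case
      by (auto simp: turning_paths_first turning_paths_unreachable binom_tail_zero_left)
  next
    case (Suc L)
    show ?case
    proof (intro impI allI conjI)
      fix n assume xy: "x \<le> y" "x + y = Suc L"
      show "card (turning_paths 1 (1 + int y - int x) n (Suc L))
        = binom_tail (Suc n div 2) n x y + binom_tail (Suc (n div 2)) n x y"
      \<comment> \<open>At \<open>x = y\<close> the level is 1, which the first upward step attains,
        so every pattern counts.\<close>
      proof (cases "x = y")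
        case True
        with xy show ?thesis
          by (auto simp: turning_paths_first binom_tail_symmetric mult_2 simp flip: xy(2))
      next
        case False
        with xy obtain y' where y': "y = Suc y'" "x \<le> y'" "x + y' = L" by (cases y) auto
        show ?thesis
        proof (cases n)
          case 0
          then show ?thesis
            using Suc.IH[of x y'] y' by (simp add: turning_paths_step binom_tail_zero_right algebra_simps)
        next
          case (Suc n')
          then show ?thesis
            using Suc.IH[of x y'] y' by (simp add: turning_paths_step binom_tail_Suc_right algebra_simps)
        qed
      qed
      show "card (turning_paths (- 1) (1 + int y - int x) n (Suc L))
        = binom_tail (Suc (n div 2)) n x y + binom_tail (Suc (Suc n div 2)) n x y"
      \<comment> \<open>At \<open>x = 0\<close> the level could be attained only by going up at
        every step, which a downward start excludes.\<close>
      proof (cases x)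
        case 0
        with xy show ?thesis
          by (simp add: turning_paths_unreachable binom_tail_zero_left)
      next
        case (Suc x')
        with xy have x': "x' \<le> y" "x' + y = L" by auto
        show ?thesis
        proof (cases n)
          case 0
          then show ?thesis
            using Suc.IH[of x' y] x' xy Suc
            by (simp add: turning_paths_step binom_tail_zero_right algebra_simps)
        next
          case (Suc n')
          then show ?thesis
            using Suc.IH[of x' y] x' xy \<open>x = Suc x'\<close>
            by (simp add: turning_paths_step binom_tail_Suc_left algebra_simps)
        qed
      qed
    qed
  qed
  from this[of "x + y"] assms
  show "card (turning_paths 1 (1 + int y - int x) n (x + y))
           = binom_tail (Suc n div 2) n x y + binom_tail (Suc (n div 2)) n x y"
    and "card (turning_paths (- 1) (1 + int y - int x) n (x + y))
           = binom_tail (Suc (n div 2)) n x y + binom_tail (Suc (Suc n div 2)) n x y"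
    by blast+
qed

section \<open>Scaling limit of the counts\<close>

text \<open>The binomial coefficient is a falling factorial with \<open>i\<close> factors over
  \<open>fact i\<close>; each factor divided by \<open>m\<close> tends to \<open>p\<close>, because
  \<open>i\<close> is fixed.\<close>

lemma binomial_asymp:
  fixes x m :: "nat \<Rightarrow> nat" and p :: real
  assumes lim: "(\<lambda>r. real (x r) / real (m r)) \<longlonglongrightarrow> p"
    and m: "filterlim (\<lambda>r. real (m r)) at_top sequentially"
  shows "(\<lambda>r. real (x r choose i) / real (m r) ^ i) \<longlonglongrightarrow> p ^ i / fact i"
proof -
  have "(\<lambda>r. (\<Prod>l=0..<i. real (x r) / real (m r) - real l / real (m r)) / fact i)
     \<longlonglongrightarrow> (\<Prod>l=0..<i. p - 0) / fact i"
    by (intro tendsto_intros lim tendsto_divide_0[OF tendsto_const]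
        filterlim_at_top_imp_at_infinity m) auto
  moreover have "(\<Prod>l=0..<i. real (x r) / real (m r) - real l / real (m r)) / fact i
      = real (x r choose i) / real (m r) ^ i" for r
    by (simp add: binomial_gbinomial gbinomial_prod_rev prod_dividef flip: diff_divide_distrib)
  ultimately show ?thesis by simp
qed

text \<open>The power of \<open>m\<close> is shared between the two binomial coefficients of each
  summand, and \<open>fact n\<close> combines the two factorials of the limit into
  \<open>n choose i\<close>. The Vandermonde tail thus becomes a binomial tail.\<close>

lemma binom_tail_asymp:
  fixes x y m :: "nat \<Rightarrow> nat" and p q :: real
  assumes "(\<lambda>r. real (x r) / real (m r)) \<longlonglongrightarrow> p" "(\<lambda>r. real (y r) / real (m r)) \<longlonglongrightarrow> q"
    and "filterlim (\<lambda>r. real (m r)) at_top sequentially"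
  shows "(\<lambda>r. fact n * real (binom_tail j n (x r) (y r)) / real (m r) ^ n)
           \<longlonglongrightarrow> (\<Sum>i=j..n. real (n choose i) * p ^ i * q ^ (n - i))"
proof -
  have "(\<lambda>r. \<Sum>i=j..n. fact n * (real (x r choose i) / real (m r) ^ i)
              * (real (y r choose (n - i)) / real (m r) ^ (n - i)))
     \<longlonglongrightarrow> (\<Sum>i=j..n. fact n * (p ^ i / fact i) * (q ^ (n - i) / fact (n - i)))"
    by (intro tendsto_intros binomial_asymp assms)
  also have "(\<lambda>r. \<Sum>i=j..n. fact n * (real (x r choose i) / real (m r) ^ i)
              * (real (y r choose (n - i)) / real (m r) ^ (n - i)))
     = (\<lambda>r. fact n * real (binom_tail j n (x r) (y r)) / real (m r) ^ n)"
    by (auto simp: fun_eq_iff binom_tail_def sum_distrib_left sum_divide_distrib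
        simp flip: power_add intro!: sum.cong)
  also have "(\<Sum>i=j..n. fact n * (p ^ i / fact i) * (q ^ (n - i) / fact (n - i)))
     = (\<Sum>i=j..n. real (n choose i) * p ^ i * q ^ (n - i))"
    by (intro sum.cong) (auto simp: binomial_fact)
  finally show ?thesis .
qed

section \<open>Discretising the telegraph process\<close>

context symmetric_telegraph
begin

lemma N_le: "\<omega> \<in> space M \<Longrightarrow> 0 \<le> s \<Longrightarrow> s \<le> u \<Longrightarrow> N s \<omega> \<le> N u \<omega>"
  using N_mono by (auto simp: mono_on_def)

lemma velocity_integrable_on:
  assumes "\<omega> \<in> space M" "0 \<le> a"
  shows "(\<lambda>s. V0 \<omega> * (- 1) ^ N s \<omega>) integrable_on {a..b}"
  by (rule integrable_on_subinterval[OF velocity_integrable[OF assms(1), of b]]) (use assms in auto)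

lemma telegraph_diff:
  assumes "\<omega> \<in> space M" "0 \<le> a" "a \<le> b"
  shows "telegraph V0 N b \<omega> - telegraph V0 N a \<omega> = integral {a..b} (\<lambda>s. V0 \<omega> * (- 1) ^ N s \<omega>)"
  using Henstock_Kurzweil_Integration.integral_combine[OF assms(2,3) velocity_integrable[OF assms(1), of b]]
  unfolding telegraph_def by linarith

lemma telegraph_lipschitz:
  assumes "\<omega> \<in> space M" "0 \<le> a" "a \<le> b"
  shows "\<bar>telegraph V0 N b \<omega> - telegraph V0 N a \<omega>\<bar> \<le> \<bar>V0 \<omega>\<bar> * (b - a)"
proof -
  have "norm (integral {a..b} (\<lambda>s. V0 \<omega> * (- 1) ^ N s \<omega>)) \<le> integral {a..b} (\<lambda>_. \<bar>V0 \<omega>\<bar>)"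
    by (rule integral_norm_bound_integral)
       (use assms in \<open>auto simp: velocity_integrable_on abs_mult power_abs\<close>)
  with assms show ?thesis
    by (simp add: telegraph_diff mult.commute)
qed

text \<open>Freezing the velocity at \<open>a\<close> causes no error at times before a jump. After
  one, the velocity error is at most twice the speed, and the increment of \<open>N\<close> is at
  least 1. Having this increment as a factor lets the errors telescope over consecutive cells, which
  gives \<open>telegraph_grid_walk\<close>.\<close>

lemma telegraph_step:
  assumes "\<omega> \<in> space M" "0 \<le> a" "a \<le> b"
  shows "\<bar>telegraph V0 N b \<omega> - telegraph V0 N a \<omega> - (b - a) * (V0 \<omega> * (- 1) ^ N a \<omega>)\<bar>
           \<le> 2 * \<bar>V0 \<omega>\<bar> * (b - a) * (real (N b \<omega>) - real (N a \<omega>))"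
proof -
  let ?g = "\<lambda>s. V0 \<omega> * (- 1) ^ N s \<omega>"
  have "norm (integral {a..b} (\<lambda>s. ?g s - ?g a))
      \<le> integral {a..b} (\<lambda>_. 2 * \<bar>V0 \<omega>\<bar> * (real (N b \<omega>) - real (N a \<omega>)))"
  proof (rule integral_norm_bound_integral)
    fix s assume s: "s \<in> {a..b}"
    show "norm (?g s - ?g a) \<le> 2 * \<bar>V0 \<omega>\<bar> * (real (N b \<omega>) - real (N a \<omega>))"
    proof (cases "N s \<omega> = N a \<omega>")
      case True
      then show ?thesis using N_le[of \<omega> a b] assms by simp
    next
      case False
      with s N_le[of \<omega> a s] N_le[of \<omega> s b] assms have "1 \<le> real (N b \<omega>) - real (N a \<omega>)"
        by simp
      then have "2 * \<bar>V0 \<omega>\<bar> * 1 \<le> 2 * \<bar>V0 \<omega>\<bar> * (real (N b \<omega>) - real (N a \<omega>))"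
        by (intro mult_left_mono) auto
      moreover have "norm (?g s - ?g a) \<le> norm (?g s) + norm (?g a)"
        by (rule norm_triangle_ineq4)
      ultimately show ?thesis
        by (simp add: abs_mult power_abs)
    qed
  qed (use assms in \<open>auto intro!: integrable_diff velocity_integrable_on\<close>)
  also have "integral {a..b} (\<lambda>s. ?g s - ?g a) = integral {a..b} ?g - (b - a) * ?g a"
    using assms by (subst Henstock_Kurzweil_Integration.integral_diff) (auto intro: velocity_integrable_on)
  finally show ?thesis
    using assms by (simp add: telegraph_diff algebra_simps)
qed

definition grid_walk :: "real \<Rightarrow> nat \<Rightarrow> 'a \<Rightarrow> real" where
  "grid_walk h j \<omega> = h * (\<Sum>i<j. V0 \<omega> * (- 1) ^ N (real i * h) \<omega>)"

lemma telegraph_grid_walk: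
  assumes "\<omega> \<in> space M" "0 \<le> h"
  shows "\<bar>telegraph V0 N (real j * h) \<omega> - grid_walk h j \<omega>\<bar> \<le> 2 * \<bar>V0 \<omega>\<bar> * h * N (real j * h) \<omega>"
proof (induction j)
  case 0
  show ?case by (simp add: telegraph_def grid_walk_def N_zero assms)
next
  case (Suc j)
  let ?a = "real j * h" and ?b = "real (Suc j) * h"
  have "\<bar>telegraph V0 N ?b \<omega> - telegraph V0 N ?a \<omega> - (?b - ?a) * (V0 \<omega> * (- 1) ^ N ?a \<omega>)\<bar>
           \<le> 2 * \<bar>V0 \<omega>\<bar> * (?b - ?a) * (real (N ?b \<omega>) - real (N ?a \<omega>))"
    using assms by (intro telegraph_step) (auto simp: algebra_simps)
  moreover have "?b - ?a = h" by (simp add: algebra_simps)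
  moreover have "grid_walk h (Suc j) \<omega> = grid_walk h j \<omega> + h * (V0 \<omega> * (- 1) ^ N ?a \<omega>)"
    by (simp add: grid_walk_def algebra_simps)
  ultimately show ?case
    using Suc by (simp only: right_diff_distrib)
qed

lemma telegraph_le_running_max:
  assumes "\<omega> \<in> space M" "0 \<le> s" "s \<le> u"
  shows "telegraph V0 N s \<omega> \<le> running_max (telegraph V0 N) u \<omega>"
  using running_max_attained[OF assms(1), of u] assms by auto

text \<open>The term with \<open>2 * N\<close> bounds the error at the grid points. The extra 1
  comes from the Lipschitz bound between the time where the maximum is attained and the grid point
  at most \<open>h\<close> before it.\<close>

lemma running_max_grid_walk:
  assumes \<omega>: "\<omega> \<in> space M" and "0 \<le> h"
  shows "\<bar>running_max (telegraph V0 N) (real m * h) \<omega> - Max ((\<lambda>j. grid_walk h j \<omega>) ` {..m})\<bar>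
           \<le> \<bar>V0 \<omega>\<bar> * h * (2 * N (real m * h) \<omega> + 1)"
proof -
  let ?R = "running_max (telegraph V0 N) (real m * h) \<omega>" and ?W = "Max ((\<lambda>j. grid_walk h j \<omega>) ` {..m})"
  let ?E = "2 * \<bar>V0 \<omega>\<bar> * h * N (real m * h) \<omega>"
  have mult_le: "real j * h \<le> real m * h" if "j \<le> m" for j
    using that \<open>0 \<le> h\<close> by (simp add: mult_right_mono)
  have err: "\<bar>telegraph V0 N (real j * h) \<omega> - grid_walk h j \<omega>\<bar> \<le> ?E" if "j \<le> m" for j
  proof -
    have "2 * \<bar>V0 \<omega>\<bar> * h * N (real j * h) \<omega> \<le> ?E"
      using N_le[OF \<omega>, of "real j * h" "real m * h"] mult_le[OF that] \<open>0 \<le> h\<close>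
      by (intro mult_left_mono) auto
    then show ?thesis using telegraph_grid_walk[OF assms, of j] by linarith
  qed
  have "?W \<in> (\<lambda>j. grid_walk h j \<omega>) ` {..m}"
    by (intro Max_in) auto
  then obtain j where j: "j \<le> m" "?W = grid_walk h j \<omega>" by (elim imageE) simp
  have "?W \<le> ?R + ?E"
    using err[OF j(1)] telegraph_le_running_max[OF \<omega>, of "real j * h" "real m * h"] mult_le[OF j(1)] j(2) \<open>0 \<le> h\<close>
    by simp
  moreover have "?R \<le> ?W + ?E + \<bar>V0 \<omega>\<bar> * h"
  proof -
    obtain s where s: "s \<in> {0..real m * h}" "?R = telegraph V0 N s \<omega>"
      using running_max_attained[OF \<omega>, of "real m * h"] \<open>0 \<le> h\<close> by auto
    obtain j where j: "j \<le> m" "real j * h \<le> s" "s \<le> real j * h + h"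
    proof (cases "h = 0")
      case True
      with s that[of 0] show thesis by auto
    next
      case False
      with \<open>0 \<le> h\<close> have "h > 0" by simp
      define j where "j = nat \<lfloor>s / h\<rfloor>"
      have "0 \<le> s / h" using s \<open>h > 0\<close> by simp
      then have *: "real j \<le> s / h" "s / h < real j + 1"
        unfolding j_def by linarith+
      then have "real j * h \<le> s" "s \<le> real j * h + h"
        using \<open>h > 0\<close> by (simp_all add: field_simps)
      moreover have "j \<le> m"
      proof -
        have "s / h \<le> real m" using s \<open>h > 0\<close> by (simp add: field_simps)
        with * show ?thesis by linarith
      qed
      ultimately show thesis using that by blast
    qed
    have "\<bar>telegraph V0 N s \<omega> - telegraph V0 N (real j * h) \<omega>\<bar> \<le> \<bar>V0 \<omega>\<bar> * (s - real j * h)"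
      by (rule telegraph_lipschitz[OF \<omega>]) (use j \<open>0 \<le> h\<close> in auto)
    also have "\<dots> \<le> \<bar>V0 \<omega>\<bar> * h"
      using j by (intro mult_left_mono) auto
    finally have "telegraph V0 N s \<omega> \<le> telegraph V0 N (real j * h) \<omega> + \<bar>V0 \<omega>\<bar> * h"
      by linarith
    moreover have "grid_walk h j \<omega> \<le> ?W"
      using j by (intro Max_ge) auto
    ultimately show ?thesis
      using err[OF j(1)] s by linarith
  qed
  moreover have "0 \<le> \<bar>V0 \<omega>\<bar> * h" using \<open>0 \<le> h\<close> by simp
  moreover have "\<bar>V0 \<omega>\<bar> * h * (2 * N (real m * h) \<omega> + 1) = ?E + \<bar>V0 \<omega>\<bar> * h"
    by (simp add: algebra_simps)
  ultimately show ?thesis by linarith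
qed

text \<open>The supremum runs over uncountably many times, so it is written as the pointwise limit
  of maxima of grid walks, each depending on finitely many \<open>N s\<close>.\<close>

lemma borel_measurable_running_max [measurable]:
  assumes "t \<ge> 0"
  shows "running_max (telegraph V0 N) t \<in> borel_measurable M"
proof (rule borel_measurable_LIMSEQ_real)
  let ?h = "\<lambda>m. t / real (Suc m)"
  show "(\<lambda>m. Max ((\<lambda>j. grid_walk (?h m) j \<omega>) ` {..Suc m})) \<longlonglongrightarrow> running_max (telegraph V0 N) t \<omega>"
    if \<omega>: "\<omega> \<in> space M" for \<omega>
  proof -
    have "(\<lambda>m. \<bar>V0 \<omega>\<bar> * t * (2 * N t \<omega> + 1) * inverse (real (Suc m))) \<longlonglongrightarrow> 0"
      using tendsto_mult_right_zero[OF LIMSEQ_inverse_real_of_nat] by blast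
    then have "(\<lambda>m. Max ((\<lambda>j. grid_walk (?h m) j \<omega>) ` {..Suc m}) - running_max (telegraph V0 N) t \<omega>) \<longlonglongrightarrow> 0"
    proof (rule Lim_null_comparison[rotated], intro always_eventually allI)
      fix m
      have "real (Suc m) * ?h m = t" by simp
      then show "norm (Max ((\<lambda>j. grid_walk (?h m) j \<omega>) ` {..Suc m}) - running_max (telegraph V0 N) t \<omega>)
          \<le> \<bar>V0 \<omega>\<bar> * t * (2 * N t \<omega> + 1) * inverse (real (Suc m))"
        using running_max_grid_walk[OF \<omega>, of "?h m" "Suc m"] assms
        by (simp add: abs_minus_commute divide_inverse mult_ac del: of_nat_Suc)
    qed
    then show ?thesis by (rule LIM_zero_cancel)
  qed
  show "(\<lambda>\<omega>. Max ((\<lambda>j. grid_walk (?h m) j \<omega>) ` {..Suc m})) \<in> borel_measurable M" for m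
  proof (rule borel_measurable_Max)
    fix j
    have [measurable]: "N (real i * ?h m) \<in> measurable M (count_space UNIV)" for i
      using assms by (intro random_variable_N) auto
    note random_variable_V0[measurable]
    show "(\<lambda>\<omega>. grid_walk (?h m) j \<omega>) \<in> borel_measurable M"
      unfolding grid_walk_def by measurable
  qed auto
qed

end

section \<open>Probabilities of jump patterns\<close>

lemma count_list_take_Suc:
  "count_list (take (Suc i) e) x = count_list (take i e) x + of_bool (i < length e \<and> e ! i = x)"
  by (cases "i < length e") (auto simp: take_Suc_conv_app_nth)

context symmetric_telegraph
begin

text \<open>
  Since \<open>take i e = e\<close> from \<open>i = length e\<close> on, there is no jump in the cell after those
  described by \<open>e\<close>; this makes all runs of the lattice walk nonempty.
\<close>

definition turning_event :: "real \<Rightarrow> bool list \<Rightarrow> 'a set" where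
  "turning_event h e =
     {\<omega> \<in> space M. \<forall>i\<le>Suc (length e). N (real i * h) \<omega> = count_list (take i e) True}"

text \<open>The event fixes independent Poisson increments to values 0 or 1, whose factorials are
  both 1. Hence only the length and the number of turns matter: patterns agreeing in both are
  equally likely.\<close>

lemma prob_turning_event:
  assumes "h > 0"
  shows "prob (turning_event h e)
           = exp (- rate * (real (Suc (length e)) * h)) * (rate * h) ^ count_list e True"
proof -
  let ?m = "Suc (length e)"
  define X where "X i \<omega> = N (real (Suc i) * h) \<omega> - N (real i * h) \<omega>" for i \<omega>
  \<comment> \<open>The last cell, \<open>i = length e\<close>, receives increment 0.\<close>
  define d :: "nat \<Rightarrow> nat" where "d i = of_bool (i < length e \<and> e ! i = True)" for i
  have cnt: "count_list (take (Suc i) e) True = count_list (take i e) True + d i" for i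
    by (simp only: count_list_take_Suc d_def)
  have "indep_vars (\<lambda>_. count_space UNIV) X {..<?m}"
    unfolding X_def
    by (rule independent_increments) (use assms in \<open>auto intro!: mult_right_mono\<close>)
  then have "prob (\<Inter>i\<in>{..<?m}. X i -` {d i} \<inter> space M) = (\<Prod>i<?m. prob (X i -` {d i} \<inter> space M))"
    by (rule indep_varsD) auto
  also have "(\<Inter>i\<in>{..<?m}. X i -` {d i} \<inter> space M) = turning_event h e"
  proof (intro equalityI subsetI)
    fix \<omega> assume \<omega>: "\<omega> \<in> (\<Inter>i\<in>{..<?m}. X i -` {d i} \<inter> space M)"
    then have sp: "\<omega> \<in> space M" using INT_D[OF \<omega>, of 0] by simp
    have "i \<le> ?m \<longrightarrow> N (real i * h) \<omega> = count_list (take i e) True" for i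
    proof (induction i)
      case (Suc i)
      show ?case
      proof
        assume i: "Suc i \<le> ?m"
        then have "X i \<omega> = d i" using INT_D[OF \<omega>, of i] by simp
        moreover have "N (real i * h) \<omega> \<le> N (real (Suc i) * h) \<omega>"
          using assms by (intro N_le[OF sp]) (auto intro!: mult_right_mono)
        ultimately have "N (real (Suc i) * h) \<omega> = N (real i * h) \<omega> + d i"
          unfolding X_def by linarith
        with Suc i show "N (real (Suc i) * h) \<omega> = count_list (take (Suc i) e) True"
          by (simp only: cnt)
      qed
    qed (simp add: N_zero[OF sp])
    with sp show "\<omega> \<in> turning_event h e" by (simp add: turning_event_def)
  next
    fix \<omega> assume \<omega>: "\<omega> \<in> turning_event h e"
    have "X i \<omega> = d i" if "i < ?m" for i
    proof -
      have "N (real (Suc i) * h) \<omega> = count_list (take (Suc i) e) True"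
        "N (real i * h) \<omega> = count_list (take i e) True"
        using \<omega> that unfolding turning_event_def by (blast intro: less_imp_le Suc_leI)+
      then show ?thesis unfolding X_def cnt by simp
    qed
    then show "\<omega> \<in> (\<Inter>i\<in>{..<?m}. X i -` {d i} \<inter> space M)"
      using \<omega> by (auto simp: turning_event_def)
  qed
  also have "(\<Prod>i<?m. prob (X i -` {d i} \<inter> space M)) = (\<Prod>i<?m. exp (- rate * h) * (rate * h) ^ d i)"
  proof (rule prod.cong[OF refl])
    fix i
    have [measurable]: "N (real j * h) \<in> measurable M (count_space UNIV)" for j
      using assms by (intro random_variable_N) auto
    have "real (Suc i) * h - real i * h = h" by (simp add: algebra_simps)
    then have *: "distr M (count_space UNIV) (X i) = measure_pmf (poisson_pmf (rate * h))"
      unfolding X_def using assms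
      by (subst poisson_increments) (auto intro!: mult_strict_right_mono)
    have "prob (X i -` {d i} \<inter> space M) = measure (distr M (count_space UNIV) (X i)) {d i}"
      unfolding X_def by (subst measure_distr) (auto simp del: of_nat_Suc)
    also have "\<dots> = exp (- rate * h) * (rate * h) ^ d i"
      unfolding * using assms rate_pos by (simp add: measure_pmf_single d_def)
    finally show "prob (X i -` {d i} \<inter> space M) = exp (- rate * h) * (rate * h) ^ d i" .
  qed
  also have "\<dots> = exp (- rate * h) ^ ?m * (rate * h) ^ (\<Sum>i<?m. d i)"
    by (simp add: prod.distrib power_sum del: prod.lessThan_Suc sum.lessThan_Suc power_Suc)
  also have "(\<Sum>i<k. d i) = count_list (take k e) True" for k
    by (induction k) (simp_all add: cnt del: take_Suc)
  also have "exp (- rate * h) ^ ?m = exp (- rate * (real ?m * h))"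
    unfolding exp_of_nat_mult[symmetric] by (simp only: mult_minus_left mult_minus_right mult_ac)
  finally show ?thesis by simp
qed

definition neg_event :: "real \<Rightarrow> bool list \<Rightarrow> 'a set" where
  "neg_event h e = {\<omega> \<in> turning_event h e. V0 \<omega> = - c}"

lemma prob_indep_V0:
  assumes "B \<in> sigma_sets (space M) {N t -` B \<inter> space M | t B. t \<ge> 0}"
  shows "prob {\<omega> \<in> B. V0 \<omega> = - c} = prob B / 2" and "{\<omega> \<in> B. V0 \<omega> = - c} \<in> events"
proof -
  let ?V = "V0 -` {- c} \<inter> space M"
  have V: "?V \<in> {V0 -` B \<inter> space M | B. B \<in> sets borel}" by auto
  have B: "B \<in> events" using indep_setD_ev2[OF V0_indep_N] assms by auto
  then have *: "{\<omega> \<in> B. V0 \<omega> = - c} = ?V \<inter> B"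
    using sets.sets_into_space by auto
  have "prob ?V = 1 / 2"
    using prob_V0_neg by (simp add: vimage_def Int_def conj_commute)
  then show "prob {\<omega> \<in> B. V0 \<omega> = - c} = prob B / 2"
    unfolding * using indep_setD[OF V0_indep_N V assms] by simp
  show "{\<omega> \<in> B. V0 \<omega> = - c} \<in> events"
    unfolding * using indep_setD_ev1[OF V0_indep_N] V B by auto
qed

text \<open>Places the event in the sigma-algebra of which \<open>V0\<close> is independent, as a
  finite intersection of conditions on single times.\<close>

lemma turning_event_sigma_sets:
  assumes "h \<ge> 0"
  shows "turning_event h e \<in> sigma_sets (space M) {N t -` B \<inter> space M | t B. t \<ge> 0}"
    (is "_ \<in> sigma_sets _ ?G")
proof -
  let ?E = "\<lambda>i. N (real i * h) -` {count_list (take i e) True} \<inter> space M"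
  have eq: "turning_event h e = (\<Inter>i\<in>{..Suc (length e)}. ?E i)"
  proof (intro equalityI subsetI)
    fix \<omega>
    assume \<omega>: "\<omega> \<in> (\<Inter>i\<in>{..Suc (length e)}. ?E i)"
    have "N (real i * h) \<omega> = count_list (take i e) True \<and> \<omega> \<in> space M" if "i \<le> Suc (length e)" for i
      using INT_D[OF \<omega>, of i] that by simp
    then show "\<omega> \<in> turning_event h e"
      unfolding turning_event_def by blast
  qed (auto simp: turning_event_def)
  have E: "?E i \<in> sigma_sets (space M) ?G" for i
    using assms by (intro sigma_sets.Basic CollectI exI[of _ "real i * h"]
        exI[of _ "{count_list (take i e) True}"]) auto
  have "sigma_algebra (space M) (sigma_sets (space M) ?G)"
    by (rule sigma_algebra_sigma_sets) auto
  then show ?thesis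
    unfolding eq using E by (intro semiring_of_sets.finite_INT ring_of_sets.axioms(1) algebra.axioms(1) sigma_algebra.axioms(1)) auto
qed

lemma prob_neg_event:
  assumes "h > 0"
  shows "prob (neg_event h e)
     = exp (- rate * (real (Suc (length e)) * h)) * (rate * h) ^ count_list e True / 2"
    and "neg_event h e \<in> events"
  using prob_indep_V0[OF turning_event_sigma_sets[of h e]] assms
  by (simp_all add: neg_event_def prob_turning_event)

lemma prob_neg_count:
  assumes "t > 0"
  shows "prob {\<omega> \<in> space M. V0 \<omega> = - c \<and> N t \<omega> = n} = exp (- rate * t) * (rate * t) ^ n / fact n / 2"
    and "{\<omega> \<in> space M. V0 \<omega> = - c \<and> N t \<omega> = n} \<in> events"
proof -
  let ?B = "N t -` {n} \<inter> space M"
  have B: "?B \<in> sigma_sets (space M) {N t -` B \<inter> space M | t B. t \<ge> 0}"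
    using assms by (intro sigma_sets.Basic CollectI exI[of _ t] exI[of _ "{n}"]) auto
  have *: "{\<omega> \<in> space M. V0 \<omega> = - c \<and> N t \<omega> = n} = {\<omega> \<in> ?B. V0 \<omega> = - c}"
    by auto
  have d: "distr M (count_space UNIV) (\<lambda>\<omega>. N t \<omega> - N 0 \<omega>) = measure_pmf (poisson_pmf (rate * (t - 0)))"
    by (rule poisson_increments) (use assms in auto)
  have [measurable]: "N t \<in> measurable M (count_space UNIV)" "N 0 \<in> measurable M (count_space UNIV)"
    using assms by (auto intro: random_variable_N)
  \<comment> \<open>Since \<open>N 0\<close> vanishes, \<open>N t\<close> is itself a Poisson
    increment.\<close>
  have "prob ?B = prob ((\<lambda>\<omega>. N t \<omega> - N 0 \<omega>) -` {n} \<inter> space M)"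
    by (rule arg_cong[where f = prob]) (auto simp: N_zero)
  also have "\<dots> = measure (distr M (count_space UNIV) (\<lambda>\<omega>. N t \<omega> - N 0 \<omega>)) {n}"
    by (subst measure_distr) auto
  also have "\<dots> = exp (- rate * t) * (rate * t) ^ n / fact n"
    unfolding d using assms rate_pos by (simp add: measure_pmf_single)
  finally show "prob {\<omega> \<in> space M. V0 \<omega> = - c \<and> N t \<omega> = n} = exp (- rate * t) * (rate * t) ^ n / fact n / 2"
    unfolding * using prob_indep_V0(1)[OF B] by simp
  show "{\<omega> \<in> space M. V0 \<omega> = - c \<and> N t \<omega> = n} \<in> events"
    unfolding * by (rule prob_indep_V0(2)[OF B])
qed

text \<open>Distinct patterns give disjoint events, because the values of \<open>N\<close> at
  consecutive grid times recover each entry. The probability is therefore a number of patterns times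
  a common weight.\<close>

lemma prob_UN_neg_event:
  assumes "h > 0" "S \<subseteq> {e. length e = L \<and> count_list e True = n}"
  shows "prob (\<Union>e\<in>S. neg_event h e)
           = real (card S) * (exp (- rate * (real (Suc L) * h)) * (rate * h) ^ n / 2)"
proof -
  have "finite S" using assms(2) by (rule finite_subset) simp
  moreover have "disjoint_family_on (neg_event h) S"
  proof (unfold disjoint_family_on_def, intro ballI impI)
    fix e e' assume e: "e \<in> S" "e' \<in> S" "e \<noteq> e'"
    then have len: "length e = L" "length e' = L" using assms(2) by auto
    show "neg_event h e \<inter> neg_event h e' = {}"
    proof (rule ccontr)
      assume "neg_event h e \<inter> neg_event h e' \<noteq> {}"
      then have eq: "count_list (take i e) True = count_list (take i e') True" if "i \<le> Suc L" for i
        using that len by (auto simp: neg_event_def turning_event_def)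
      have "e ! i = e' ! i" if "i < L" for i
        using eq[of i] eq[of "Suc i"] that len
        by (auto simp: count_list_take_Suc of_bool_def split: if_splits)
      then have "e = e'" using len by (intro nth_equalityI) auto
      with e show False by simp
    qed
  qed
  moreover have "neg_event h ` S \<subseteq> events"
    using prob_neg_event(2)[OF assms(1)] by auto
  ultimately have "prob (\<Union>e\<in>S. neg_event h e) = (\<Sum>e\<in>S. prob (neg_event h e))"
    by (intro finite_measure_finite_Union)
  also have "\<dots> = (\<Sum>e\<in>S. exp (- rate * (real (Suc L) * h)) * (rate * h) ^ n / 2)"
    using assms by (intro sum.cong) (auto simp: prob_neg_event)
  finally show ?thesis by simp
qed

section \<open>The maximum on a pattern event\<close>

lemma grid_walk_neg_event:
  assumes "\<omega> \<in> neg_event h e" "j \<le> Suc (Suc (length e))"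
  shows "grid_walk h j \<omega> = c * h * of_int (\<Sum>i<j. (- 1) * (- 1) ^ count_list (take i e) True)"
proof -
  have "(\<Sum>i<j. V0 \<omega> * (- 1) ^ N (real i * h) \<omega>) = (\<Sum>i<j. c * (- 1 * (- 1) ^ count_list (take i e) True))"
    using assms by (intro sum.cong) (auto simp: neg_event_def turning_event_def)
  then show ?thesis
    by (simp add: grid_walk_def sum_negf flip: sum_distrib_left)
qed

lemma neg_event_count:
  assumes "\<omega> \<in> neg_event h e"
  shows "\<omega> \<in> space M" "V0 \<omega> = - c" "N (real (Suc (length e)) * h) \<omega> = count_list e True"
  using assms by (auto simp: neg_event_def turning_event_def simp del: of_nat_Suc)

text \<open>On a pattern event the grid walk is \<open>c * h\<close> times the lattice walk, and the
  error in \<open>running_max_grid_walk\<close> amounts to \<open>2 * n + 1\<close> lattice units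
  for \<open>n\<close> turns.\<close>

lemma running_max_neg_event_ge:
  assumes \<omega>: "\<omega> \<in> neg_event h e" and "h \<ge> 0" and "reaches (- 1) b e"
  shows "c * h * (real_of_int b - (2 * count_list e True + 1))
           \<le> running_max (telegraph V0 N) (real (Suc (length e)) * h) \<omega>"
proof -
  let ?m = "Suc (length e)"
  obtain j where j: "j \<le> length e" "b \<le> (\<Sum>i\<le>j. (- 1) * (- 1) ^ count_list (take i e) True)"
    using assms(3) unfolding reaches_def by blast
  have "c * h * real_of_int b \<le> grid_walk h (Suc j) \<omega>"
    using j assms(2) speed_pos
    by (subst grid_walk_neg_event[OF \<omega>]) (auto intro!: mult_left_mono simp only: lessThan_Suc_atMost of_int_le_iff, auto)
  also have "\<dots> \<le> Max ((\<lambda>j. grid_walk h j \<omega>) ` {..?m})"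
    using j by (intro Max_ge) auto
  finally show ?thesis
    using running_max_grid_walk[OF neg_event_count(1)[OF \<omega>] assms(2), of ?m] speed_pos
    unfolding neg_event_count(2,3)[OF \<omega>] abs_le_iff right_diff_distrib
    by (simp del: Max_le_iff Max_ge_iff of_nat_Suc)
qed

text \<open>Counterpart of the previous bound. The condition \<open>b \<ge> 1\<close> takes care of
  the starting point 0, which belongs to the maximum of the grid walk but is not inspected by
  \<open>reaches\<close>.\<close>

lemma running_max_neg_event_less:
  assumes \<omega>: "\<omega> \<in> neg_event h e" and "h > 0" and "\<not> reaches (- 1) b e" and "b \<ge> 1"
  shows "running_max (telegraph V0 N) (real (Suc (length e)) * h) \<omega>
           < c * h * (real_of_int b + (2 * count_list e True + 1))"
proof -
  let ?m = "Suc (length e)"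
  have "grid_walk h j \<omega> < c * h * real_of_int b" if "j \<le> ?m" for j
  proof -
    have "(\<Sum>i<j. (- 1) * (- 1) ^ count_list (take i e) True) < b"
    proof (cases j)
      case 0
      with assms(4) show ?thesis by simp
    next
      case (Suc j')
      with that assms(3) show ?thesis
        unfolding reaches_def Suc lessThan_Suc_atMost by (meson Suc_le_mono not_le)
    qed
    then show ?thesis
      using that assms(2) speed_pos
      by (subst grid_walk_neg_event[OF \<omega>]) (auto intro!: mult_strict_left_mono simp only: of_int_less_iff, auto)
  qed
  then have "Max ((\<lambda>j. grid_walk h j \<omega>) ` {..?m}) < c * h * real_of_int b"
    by (subst Max_less_iff) auto
  then show ?thesis
    using running_max_grid_walk[OF neg_event_count(1)[OF \<omega>], of h ?m] assms(2) speed_pos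
    unfolding neg_event_count(2,3)[OF \<omega>] abs_le_iff distrib_left[of "c * h" "real_of_int b"]
    by (simp del: Max_less_iff Max_le_iff Max_ge_iff of_nat_Suc)
qed

end

section \<open>The tail of the maximum\<close>

text \<open>\<open>P(B \<ge> n div 2 + 1) + P(B \<ge> (n + 1) div 2 + 1)\<close> for \<open>B\<close> binomial with parameters \<open>n\<close> and \<open>p\<close>.\<close>

definition max_tail :: "nat \<Rightarrow> real \<Rightarrow> real" where
  "max_tail n p = (\<Sum>i=Suc (n div 2)..n. real (n choose i) * p ^ i * (1 - p) ^ (n - i))
                + (\<Sum>i=Suc (Suc n div 2)..n. real (n choose i) * p ^ i * (1 - p) ^ (n - i))"

lemma eventually_linear_ge:
  assumes "(a :: real) > 0"
  shows "eventually (\<lambda>L. b \<le> a * real (Suc L)) sequentially"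
proof -
  obtain L0 :: nat where "b / a \<le> real L0" using real_arch_simple by blast
  then have "b \<le> a * real (Suc L)" if "L0 \<le> L" for L
    using that assms by (simp add: field_simps) (smt (verit) mult_left_mono of_nat_mono)
  then show ?thesis by (auto simp: eventually_sequentially)
qed

lemma tendsto_Suc_quotient: "(\<lambda>L. real L / real (Suc L)) \<longlonglongrightarrow> 1"
  using LIMSEQ_n_over_Suc_n by simp

lemma filterlim_real_Suc: "filterlim (\<lambda>L. real (Suc L)) at_top sequentially"
  by (rule filterlim_compose[OF filterlim_real_sequentially filterlim_Suc])

context
  fixes p :: real and d :: int and x :: "nat \<Rightarrow> nat"
  assumes p: "0 < p" "p < 1 / 2"
  defines "x \<equiv> \<lambda>L. nat (\<lfloor>p * real (Suc L)\<rfloor> + d)"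
begin

text \<open>The fixed shift \<open>d\<close> will absorb the discretisation error of a bounded
  number of lattice units; it disappears in the limit \<open>x / m\<close>.\<close>

lemma eventually_x_bounds:
  "eventually (\<lambda>L. real (x L) = of_int \<lfloor>p * real (Suc L)\<rfloor> + of_int d \<and> x L \<le> L - x L \<and> x L \<le> L)
     sequentially"
proof -
  \<comment> \<open>The first inequality makes the argument of \<open>nat\<close> nonnegative, so
    nothing is truncated; the second gives \<open>2 * x L \<le> L\<close>.\<close>
  have "eventually (\<lambda>L. 1 - real_of_int d \<le> p * real (Suc L)) sequentially"
    "eventually (\<lambda>L. 1 + 2 * real_of_int d \<le> (1 - 2 * p) * real (Suc L)) sequentially"
    by (rule eventually_linear_ge, use p in simp)+
  then show ?thesis
  proof eventually_elim
    case (elim L)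
    have "0 \<le> \<lfloor>p * real (Suc L)\<rfloor> + d" using elim(1) by linarith
    then have 1: "real (x L) = of_int \<lfloor>p * real (Suc L)\<rfloor> + of_int d" by (simp add: x_def)
    also have "\<dots> \<le> p * real (Suc L) + of_int d" by linarith
    finally have "2 * real (x L) \<le> real L"
      using elim(2) by (simp add: algebra_simps)
    then have "2 * x L \<le> L" by linarith
    with 1 show ?case by auto
  qed
qed

lemma tendsto_x: "(\<lambda>L. real (x L) / real (Suc L)) \<longlonglongrightarrow> p"
proof -
  have lim: "(\<lambda>L. p + a * inverse (real (Suc L))) \<longlonglongrightarrow> p + a * 0" for a
    by (intro tendsto_intros LIMSEQ_inverse_real_of_nat)
  have eq: "p + a * inverse (real (Suc L)) = (p * real (Suc L) + a) / real (Suc L)" for a L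
    by (simp add: field_simps del: of_nat_Suc)
  show ?thesis
  proof (rule tendsto_sandwich)
    show "(\<lambda>L. p + (real_of_int d - 1) * inverse (real (Suc L))) \<longlonglongrightarrow> p"
      "(\<lambda>L. p + real_of_int d * inverse (real (Suc L))) \<longlonglongrightarrow> p"
      using lim[of "real_of_int d - 1"] lim[of "real_of_int d"] by simp_all
    show "eventually (\<lambda>L. p + (real_of_int d - 1) * inverse (real (Suc L)) \<le> real (x L) / real (Suc L)) sequentially"
      using eventually_x_bounds
    proof eventually_elim
      case (elim L)
      then have "p * real (Suc L) + (real_of_int d - 1) \<le> real (x L)" by linarith
      then show ?case
        unfolding eq by (intro divide_right_mono) auto
    qed
    show "eventually (\<lambda>L. real (x L) / real (Suc L) \<le> p + real_of_int d * inverse (real (Suc L))) sequentially"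
      using eventually_x_bounds
    proof eventually_elim
      case (elim L)
      then have "real (x L) \<le> p * real (Suc L) + real_of_int d" by linarith
      then show ?case
        unfolding eq by (intro divide_right_mono) auto
    qed
  qed
qed

lemma card_turning_paths_asymp:
  "(\<lambda>L. fact n * real (card (turning_paths (- 1) (1 + int (L - x L) - int (x L)) n L)) / real (Suc L) ^ n)
     \<longlonglongrightarrow> max_tail n p"
proof -
  have "(\<lambda>L. real L / real (Suc L) - real (x L) / real (Suc L)) \<longlonglongrightarrow> 1 - p"
    by (intro tendsto_intros tendsto_x tendsto_Suc_quotient)
  moreover have "eventually (\<lambda>L. real L / real (Suc L) - real (x L) / real (Suc L)
      = real (L - x L) / real (Suc L)) sequentially"
    using eventually_x_bounds by eventually_elim (simp add: of_nat_diff diff_divide_distrib)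
  ultimately have y: "(\<lambda>L. real (L - x L) / real (Suc L)) \<longlonglongrightarrow> 1 - p"
    by (rule Lim_transform_eventually)
  have "(\<lambda>L. fact n * real (binom_tail (Suc (n div 2)) n (x L) (L - x L)) / real (Suc L) ^ n
           + fact n * real (binom_tail (Suc (Suc n div 2)) n (x L) (L - x L)) / real (Suc L) ^ n)
      \<longlonglongrightarrow> max_tail n p"
    unfolding max_tail_def
    by (intro tendsto_add binom_tail_asymp tendsto_x y filterlim_real_Suc)
  moreover have "eventually (\<lambda>L.
      fact n * real (binom_tail (Suc (n div 2)) n (x L) (L - x L)) / real (Suc L) ^ n
           + fact n * real (binom_tail (Suc (Suc n div 2)) n (x L) (L - x L)) / real (Suc L) ^ n
      = fact n * real (card (turning_paths (- 1) (1 + int (L - x L) - int (x L)) n L)) / real (Suc L) ^ n)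
      sequentially"
    using eventually_x_bounds
  proof eventually_elim
    case (elim L)
    then show ?case
      using card_turning_paths(2)[of "x L" "L - x L" n]
      by (simp add: distrib_left add_divide_distrib)
  qed
  ultimately show ?thesis
    by (rule Lim_transform_eventually)
qed

end

context symmetric_telegraph
begin

text \<open>The event is bracketed by pattern events for two slightly shifted levels, and the
  outcomes that follow no pattern are added to the upper bound. Both bounds have the same
  limit.\<close>

lemma prob_running_max_gt:
  assumes t: "t > 0" and \<beta>: "0 < \<beta>" "\<beta> < c * t"
  shows "prob {\<omega> \<in> space M. V0 \<omega> = - c \<and> N t \<omega> = n \<and> running_max (telegraph V0 N) t \<omega> > \<beta>}
      = exp (- rate * t) * (rate * t) ^ n / fact n / 2 * max_tail n ((1 - \<beta> / (c * t)) / 2)"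
proof -
  define p where "p = (1 - \<beta> / (c * t)) / 2"
  have ct: "c * t > 0" using t speed_pos by simp
  have p: "0 < p" "p < 1 / 2" using \<beta> ct by (auto simp: p_def field_simps)
  \<comment> \<open>In lattice units of size \<open>c * t / m\<close>, the threshold is
    \<open>m - 2 * p * m\<close>, which is the level \<open>m - 2 * x\<close> for
    \<open>x = p * m\<close>.\<close>
  have \<beta>_eq: "\<beta> = c * t * (1 - 2 * p)" using t speed_pos by (simp add: p_def field_simps)
  define A where "A = {\<omega> \<in> space M. V0 \<omega> = - c \<and> N t \<omega> = n}"
  define B where "B = {\<omega> \<in> space M. V0 \<omega> = - c \<and> N t \<omega> = n \<and> running_max (telegraph V0 N) t \<omega> > \<beta>}"
  define q where "q = exp (- rate * t) * (rate * t) ^ n / fact n / 2"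
  define h where "h L = t / real (Suc L)" for L :: nat
  have h: "h L > 0" "real (Suc L) * h L = t" for L using t by (simp_all add: h_def)
  have A: "A \<in> events" "prob A = q"
    using prob_neg_count[OF t, of n] by (simp_all add: A_def q_def)
  have [measurable]: "running_max (telegraph V0 N) t \<in> borel_measurable M"
    using t by simp
  have "B = A \<inter> {\<omega> \<in> space M. running_max (telegraph V0 N) t \<omega> > \<beta>}" by (auto simp: A_def B_def)
  then have B: "B \<in> events" using A by simp
  define T where "T d L = turning_paths (- 1) (1 + int (L - nat (\<lfloor>p * real (Suc L)\<rfloor> + d))
      - int (nat (\<lfloor>p * real (Suc L)\<rfloor> + d))) n L" for d :: int and L :: nat
  have T_sub: "T d L \<subseteq> {e. length e = L \<and> count_list e True = n}" for d L
    by (auto simp: T_def turning_paths_def)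
  have P_UN: "prob (\<Union>e\<in>S. neg_event (h L) e) = q * (fact n * real (card S) / real (Suc L) ^ n)"
    if "S \<subseteq> {e. length e = L \<and> count_list e True = n}" for S L
    unfolding prob_UN_neg_event[OF h(1) that] h(2)
    by (simp add: h_def q_def power_divide mult_ac del: of_nat_Suc)
  have UN_events: "(\<Union>e\<in>S. neg_event (h L) e) \<in> events"
    if "S \<subseteq> {e. length e = L \<and> count_list e True = n}" for S L
    by (rule sets.finite_UN[OF finite_subset[OF that finite_bool_lists]]) (rule prob_neg_event(2)[OF h(1)])
  have T_lim: "(\<lambda>L. q * (fact n * real (card (T d L)) / real (Suc L) ^ n)) \<longlonglongrightarrow> q * max_tail n p" for d
    unfolding T_def by (intro tendsto_mult_left card_turning_paths_asymp p)
  define C where "C L = {e :: bool list. length e = L \<and> count_list e True = n}" for L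
  \<comment> \<open>The number of all patterns is \<open>L choose n\<close>, so in the limit they
    exhaust the conditioning event \<open>A\<close>.\<close>
  have C_lim: "(\<lambda>L. q * (fact n * real (card (C L)) / real (Suc L) ^ n)) \<longlonglongrightarrow> q"
  proof -
    have "(\<lambda>L. q * (fact n * (real (L choose n) / real (Suc L) ^ n))) \<longlonglongrightarrow> q * (fact n * (1 ^ n / fact n))"
      by (intro tendsto_mult_left binomial_asymp tendsto_Suc_quotient filterlim_real_Suc)
    then show ?thesis by (simp add: C_def card_bool_lists_count)
  qed
  have sub_A: "neg_event (h L) e \<subseteq> A" if "e \<in> C L" for e L
    using that neg_event_count[of _ "h L" e] h(2)[of L] by (auto simp: C_def A_def)
  have level: "real_of_int (1 + int (L - x) - int x) = real (Suc L) - 2 * real x" if "x \<le> L" for x L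
    using that by (simp add: of_nat_diff)
  have chL: "c * h L * real (Suc L) = c * t" for L
    using h(2)[of L] by (simp add: mult_ac)
  \<comment> \<open>Lowering \<open>x\<close> by \<open>n + 1\<close> raises the level by
    \<open>2 * n + 2\<close>, which exceeds the error of \<open>2 * n + 1\<close> units and so gives
    the strict inequality.\<close>
  have lower: "eventually (\<lambda>L. q * (fact n * real (card (T (- int n - 1) L)) / real (Suc L) ^ n) \<le> prob B) sequentially"
    using eventually_x_bounds[OF p, of "- int n - 1"]
  proof eventually_elim
    case (elim L)
    define x where "x = nat (\<lfloor>p * real (Suc L)\<rfloor> + (- int n - 1))"
    have "real_of_int (- int n - 1) = - real n - 1" by simp
    with elim[folded x_def] have x: "real x \<le> p * real (Suc L) - real n - 1" "x \<le> L"
      by linarith+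
    have "neg_event (h L) e \<subseteq> B" if e: "e \<in> T (- int n - 1) L" for e
    proof
      fix \<omega> assume \<omega>: "\<omega> \<in> neg_event (h L) e"
      have e': "e \<in> C L" "length e = L" "count_list e True = n" "reaches (- 1) (1 + int (L - x) - int x) e"
        using e by (auto simp: T_def turning_paths_def C_def x_def)
      have "\<beta> = c * h L * ((1 - 2 * p) * real (Suc L))"
        unfolding \<beta>_eq chL[of L, symmetric] by simp
      also have "\<dots> < c * h L * (real (Suc L) - 2 * real x - (2 * real n + 1))"
        using x(1) h(1)[of L] speed_pos by (intro mult_strict_left_mono) (auto simp: algebra_simps)
      also have "\<dots> \<le> running_max (telegraph V0 N) t \<omega>"
        using running_max_neg_event_ge[OF \<omega> _ e'(4)] h(1)[of L]
        unfolding level[OF x(2)] e'(2,3) h(2) by simp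
      finally show "\<omega> \<in> B" using sub_A[OF e'(1)] \<omega> by (auto simp: A_def B_def)
    qed
    then have "prob (\<Union>e\<in>T (- int n - 1) L. neg_event (h L) e) \<le> prob B"
      by (intro finite_measure_mono B) auto
    then show ?case by (simp add: P_UN[OF T_sub])
  qed
  \<comment> \<open>Here the level has to drop by at least \<open>2 * n + 1\<close>. A shift by
    \<open>n + 2\<close> ensures this even though the floor may lose almost 1. The last summand is
    the probability of the part of \<open>A\<close> outside all patterns.\<close>
  have upper: "eventually (\<lambda>L. prob B \<le> q * (fact n * real (card (T (int n + 2) L)) / real (Suc L) ^ n)
      + (q - q * (fact n * real (card (C L)) / real (Suc L) ^ n))) sequentially"
    using eventually_x_bounds[OF p, of "int n + 2"]
  proof eventually_elim
    case (elim L)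
    define x where "x = nat (\<lfloor>p * real (Suc L)\<rfloor> + (int n + 2))"
    have "real_of_int (int n + 2) = real n + 2" by simp
    with elim[folded x_def] have x: "real x \<ge> p * real (Suc L) + real n + 1" "x \<le> L" "x \<le> L - x"
      by linarith+
    let ?U = "\<Union>e\<in>T (int n + 2) L. neg_event (h L) e" and ?V = "\<Union>e\<in>C L. neg_event (h L) e"
    have "\<omega> \<in> ?U \<union> (A - ?V)" if \<omega>: "\<omega> \<in> B" for \<omega>
    proof (cases "\<omega> \<in> ?V")
      case True
      then obtain e where e: "e \<in> C L" "\<omega> \<in> neg_event (h L) e" by auto
      then have len: "length e = L" "count_list e True = n" by (auto simp: C_def)
      have "reaches (- 1) (1 + int (L - x) - int x) e"
      proof (rule ccontr)
        assume nr: "\<not> reaches (- 1) (1 + int (L - x) - int x) e"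
        have "running_max (telegraph V0 N) t \<omega> < c * h L * (real (Suc L) - 2 * real x + (2 * real n + 1))"
          using running_max_neg_event_less[OF e(2) h(1) nr] x(3)
          unfolding level[OF x(2)] len h(2) by simp
        also have "\<dots> \<le> c * h L * ((1 - 2 * p) * real (Suc L))"
          using x(1) h(1)[of L] speed_pos by (intro mult_left_mono) (auto simp: algebra_simps)
        also have "\<dots> = \<beta>"
          unfolding \<beta>_eq chL[of L, symmetric] by simp
        finally show False using \<omega> by (simp add: B_def)
      qed
      with e len show ?thesis by (auto simp: T_def turning_paths_def x_def)
    next
      case False
      with \<omega> show ?thesis by (auto simp: A_def B_def)
    qed
    then have "prob B \<le> prob (?U \<union> (A - ?V))"
      using UN_events[OF T_sub] UN_events[of "C L" L] A
      by (intro finite_measure_mono) (auto simp: C_def)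
    also have "\<dots> \<le> prob ?U + prob (A - ?V)"
      using UN_events[OF T_sub] UN_events[of "C L" L] A
      by (intro measure_Un_le) (auto simp: C_def)
    also have "prob (A - ?V) = prob A - prob ?V"
      using UN_events[of "C L" L] A sub_A
      by (intro finite_measure_Diff) (auto simp: C_def)
    also have "prob ?V = q * (fact n * real (card (C L)) / real (Suc L) ^ n)"
      by (rule P_UN) (simp add: C_def)
    finally show ?case by (simp only: P_UN[OF T_sub] A(2))
  qed
  have "q * max_tail n p \<le> prob B"
    by (rule tendsto_upperbound[OF T_lim lower]) simp
  moreover have "prob B \<le> q * max_tail n p + (q - q)"
    by (rule tendsto_lowerbound[OF tendsto_add[OF T_lim tendsto_diff[OF tendsto_const C_lim]] upper]) simp
  ultimately show ?thesis unfolding B_def q_def p_def by simp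
qed

end

section \<open>Density and atom\<close>

lemma sum_binomial_upper_half:
  "(\<Sum>i=Suc k..2 * k + 1. (2 * k + 1) choose i) = (2 :: nat) ^ (2 * k)"
proof -
  define n where "n = 2 * k + 1"
  have sym: "n choose (n - i) = n choose i" if "i \<le> n" for i
    using that by (rule binomial_symmetric[symmetric])
  have "(\<Sum>i=Suc k..n. n choose i) = (\<Sum>i\<le>k. n choose i)"
    by (rule sum.reindex_bij_witness[of _ "\<lambda>i. n - i" "\<lambda>i. n - i"]) (auto simp: sym, auto simp: n_def)
  moreover have "{..n} = {..k} \<union> {Suc k..n}" by (auto simp: n_def)
  then have "(\<Sum>i\<le>n. n choose i) = (\<Sum>i\<le>k. n choose i) + (\<Sum>i=Suc k..n. n choose i)"
    by (simp only:) (subst sum.union_disjoint, auto)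
  ultimately show ?thesis
    using choose_row_sum[of n] by (simp add: n_def)
qed

text \<open>At \<open>p = 1 / 2\<close> the first tail is the upper half of an odd row and equals
  1/2; the second is the same without its lowest term, which accounts for the defect.\<close>

lemma max_tail_half:
  "max_tail (2 * k + 1) (1 / 2) = 1 - real ((2 * k + 1) choose k) * (1 / 2 ^ (2 * k + 1))"
proof -
  let ?n = "2 * k + 1"
  have "real (?n choose i) * (1 / 2) ^ i * (1 - 1 / 2) ^ (?n - i) = real (?n choose i) / 2 ^ ?n"
    if "i \<in> {j..?n}" for i j
  proof -
    have "(1 / 2 :: real) ^ i * (1 / 2) ^ (?n - i) = (1 / 2) ^ ?n"
      using that by (simp flip: power_add)
    then show ?thesis by (simp add: power_divide)
  qed
  then have s: "(\<Sum>i=j..?n. real (?n choose i) * (1 / 2) ^ i * (1 - 1 / 2) ^ (?n - i))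
      = real (\<Sum>i=j..?n. ?n choose i) / 2 ^ ?n" for j
    unfolding of_nat_sum sum_divide_distrib by (intro sum.cong refl)
  have "(\<Sum>i=Suc k..?n. ?n choose i) = (?n choose Suc k) + (\<Sum>i=Suc (Suc k)..?n. ?n choose i)"
    by (rule sum.atLeast_Suc_atMost) simp
  moreover have "?n choose Suc k = ?n choose k"
    using binomial_symmetric[of k ?n] by simp
  ultimately have "real (2 ^ (2 * k)) = real ((?n choose k) + (\<Sum>i=Suc (Suc k)..?n. ?n choose i))"
    unfolding sum_binomial_upper_half by (simp only:)
  then have u: "real (\<Sum>i=Suc (Suc k)..?n. ?n choose i) = 2 ^ (2 * k) - real (?n choose k)"
    unfolding of_nat_add of_nat_power of_nat_numeral by linarith
  have d: "Suc (?n div 2) = Suc k" "Suc (Suc ?n div 2) = Suc (Suc k)" by simp_all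
  have "max_tail ?n (1 / 2) = real (2 ^ (2 * k)) / 2 ^ ?n + (2 ^ (2 * k) - real (?n choose k)) / 2 ^ ?n"
    unfolding max_tail_def s d u unfolding sum_binomial_upper_half ..
  then show ?thesis
    by (simp add: field_simps)
qed

lemma max_tail_zero: "max_tail n 0 = 0"
proof -
  have "(\<Sum>i=Suc j..n. real (n choose i) * 0 ^ i * (1 - 0) ^ (n - i)) = (0 :: real)" for j
    by (intro sum.neutral) auto
  then show ?thesis by (simp only: max_tail_def add_0)
qed

text \<open>The derivative is the density of the order statistic of rank \<open>l + 1\<close> among
  \<open>m + 1\<close> uniform variables. The proof adds summands from the top, starting at the
  empty sum for \<open>l = Suc m\<close>; the negative part of each new derivative cancels the
  derivative of the old tail.\<close>

lemma has_real_derivative_binomial_tail: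
  "((\<lambda>p. \<Sum>i=Suc l..Suc m. real (Suc m choose i) * p ^ i * (1 - p) ^ (Suc m - i))
      has_real_derivative real (Suc m) * real (m choose l) * p ^ l * (1 - p) ^ (m - l)) (at p)"
proof (cases "l \<le> Suc m")
  case False
  then show ?thesis by (simp add: binomial_eq_0)
next
  case True
  then show ?thesis
  proof (induction l rule: inc_induct)
    case base
    show ?case by (simp add: binomial_eq_0)
  next
    case (step l)
    let ?g = "\<lambda>l p. \<Sum>i=Suc l..Suc m. real (Suc m choose i) * p ^ i * (1 - p) ^ (Suc m - i)"
    have le: "l \<le> m" using step by simp
    then have g: "?g l = (\<lambda>p. real (Suc m choose Suc l) * (p ^ Suc l * (1 - p) ^ (m - l)) + ?g (Suc l) p)"
      by (subst sum.atLeast_Suc_atMost) (auto simp: mult.assoc simp del: binomial_Suc_Suc sum.cl_ivl_Suc)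
    have d1: "((\<lambda>p. p ^ Suc l) has_real_derivative real (Suc l) * p ^ l) (at p)"
      using DERIV_pow[of "Suc l" p] by simp
    have "((\<lambda>p. 1 - p) has_real_derivative - 1) (at p)"
      by (auto intro!: derivative_eq_intros)
    from DERIV_power[OF this, of "m - l"]
    have d2: "((\<lambda>p. (1 - p) ^ (m - l)) has_real_derivative - (real (m - l) * (1 - p) ^ (m - l - 1))) (at p)"
      by simp
    have dg: "((\<lambda>p. real (Suc m choose Suc l) * (p ^ Suc l * (1 - p) ^ (m - l))) has_real_derivative
        real (Suc m choose Suc l) * (real (Suc l) * p ^ l * (1 - p) ^ (m - l)
          - p ^ Suc l * (real (m - l) * (1 - p) ^ (m - l - 1)))) (at p)"
      by (rule DERIV_cong[OF DERIV_cmult[OF DERIV_mult[OF d1 d2]]])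
         (simp add: mult.commute del: binomial_Suc_Suc power_Suc of_nat_Suc)
    \<comment> \<open>Absorption identities: they give the two parts of the product rule the
      coefficients needed for the cancellation.\<close>
    have eqs: "real (Suc l) * real (Suc m choose Suc l) = real (Suc m) * real (m choose l)"
      "real (m - l) * real (Suc m choose Suc l) = real (Suc m) * real (m choose Suc l)"
      using Suc_times_binomial_eq[of m l] binomial_absorb_comp[of "Suc m" "Suc l"]
      by (metis of_nat_mult mult.commute, metis diff_Suc_1 diff_Suc_Suc of_nat_mult)
    have "real (Suc m choose Suc l) * (real (Suc l) * p ^ l * (1 - p) ^ (m - l)
          - p ^ Suc l * (real (m - l) * (1 - p) ^ (m - l - 1)))
          + real (Suc m) * real (m choose Suc l) * p ^ Suc l * (1 - p) ^ (m - Suc l)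
        = (real (Suc l) * real (Suc m choose Suc l)) * (p ^ l * (1 - p) ^ (m - l))
          - (real (m - l) * real (Suc m choose Suc l)) * (p ^ Suc l * (1 - p) ^ (m - Suc l))
          + real (Suc m) * real (m choose Suc l) * (p ^ Suc l * (1 - p) ^ (m - Suc l))"
      by (simp add: algebra_simps del: binomial_Suc_Suc power_Suc of_nat_Suc)
    also have "\<dots> = real (Suc m) * real (m choose l) * p ^ l * (1 - p) ^ (m - l)"
      unfolding eqs by simp
    finally have "real (Suc m choose Suc l) * (real (Suc l) * p ^ l * (1 - p) ^ (m - l)
          - p ^ Suc l * (real (m - l) * (1 - p) ^ (m - l - 1)))
          + real (Suc m) * real (m choose Suc l) * p ^ Suc l * (1 - p) ^ (m - Suc l)
        = real (Suc m) * real (m choose l) * p ^ l * (1 - p) ^ (m - l)" .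
    then show ?case
      unfolding g using DERIV_add[OF dg step.IH] by (simp only:)
  qed
qed

section \<open>From a tail function to a density\<close>

text \<open>The tails determine the law inside the interval, and the fundamental theorem of calculus
  identifies them with integrals of \<open>f\<close>. Continuity of \<open>H\<close> settles both
  ends: no mass lies at or beyond \<open>b\<close>, and the tail formula extends to
  \<open>a\<close>, from which an atom at \<open>a\<close> can be read off when nothing lies
  below.\<close>

lemma restrict_space_eq_density:
  fixes D :: "real measure" and a b :: real
  assumes D: "finite_measure D" "sets D = sets borel" and ab: "a < b"
    and f: "f \<in> borel_measurable borel" "\<And>x. x \<in> {a..b} \<Longrightarrow> 0 \<le> f x"
    and H: "\<And>x. (H has_real_derivative - f x) (at x)" "H b = 0"
    and tail: "\<And>x. x \<in> {a<..<b} \<Longrightarrow> measure D {x<..} = H x"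
  shows "restrict_space D {a<..<b} = density (restrict_space lborel {a<..<b}) (\<lambda>x. ennreal (f x))"
    and "measure D {a<..} = H a"
proof -
  interpret finite_measure D by fact
  note [simp, measurable_cong] = D(2)
  note [measurable] = f(1)
  have cont: "isCont H x" for x using H(1) by (rule DERIV_isCont)
  \<comment> \<open>A sequence inside the interval decreasing to \<open>a\<close>; its mirror image
    \<open>a + b - y n\<close> increases to \<open>b\<close>. The double \<open>Suc\<close> keeps
    the first member away from \<open>b\<close>.\<close>
  define y where "y n = a + (b - a) * inverse (real (Suc (Suc n)))" for n
  have y: "y n \<in> {a<..<b}" for n
  proof -
    define d where "d = (b - a) * inverse (real (Suc (Suc n)))"
    have "d < (b - a) * 1"
      unfolding d_def using ab by (intro mult_strict_left_mono) (auto simp: field_simps)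
    moreover have "0 < d"
      unfolding d_def using ab by (intro mult_pos_pos) auto
    ultimately show ?thesis unfolding y_def d_def[symmetric] by simp
  qed
  have inv: "(\<lambda>n. inverse (real (Suc (Suc n)))) \<longlonglongrightarrow> 0"
    using LIMSEQ_inverse_real_of_nat by (rule LIMSEQ_Suc)
  have y_lim: "y \<longlonglongrightarrow> a"
    unfolding y_def using tendsto_add[OF tendsto_const[of a] tendsto_mult_right_zero[OF inv, of "b - a"]] by simp
  have z_lim: "(\<lambda>n. a + b - y n) \<longlonglongrightarrow> b"
    using tendsto_diff[OF tendsto_const[of "a + b"] y_lim] by simp
  show tail_a: "measure D {a<..} = H a"
  proof (rule LIMSEQ_unique)
    show "(\<lambda>n. measure D {y n<..}) \<longlonglongrightarrow> H a"
      using isCont_tendsto_compose[OF cont y_lim] by (simp add: tail[OF y])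
    have "incseq (\<lambda>n. {y n<..})"
    proof (rule incseq_SucI)
      fix n
      have "y (Suc n) \<le> y n"
        using ab unfolding y_def by (intro add_left_mono mult_left_mono) (auto simp: field_simps)
      then show "{y n<..} \<subseteq> {y (Suc n)<..}" by auto
    qed
    moreover have "(\<Union>n. {y n<..}) = {a<..}"
    proof (intro equalityI subsetI)
      fix x assume "x \<in> {a<..}"
      then have "eventually (\<lambda>n. y n < x) sequentially"
        by (intro order_tendstoD(2)[OF y_lim]) simp
      then show "x \<in> (\<Union>n. {y n<..})" by (auto simp: eventually_sequentially)
    next
      fix x assume "x \<in> (\<Union>n. {y n<..})"
      then obtain n where "y n < x" by auto
      with y[of n] show "x \<in> {a<..}" by auto
    qed
    ultimately show "(\<lambda>n. measure D {y n<..}) \<longlonglongrightarrow> measure D {a<..}"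
      by (intro finite_Lim_measure_incseq[of "\<lambda>n. {y n<..}", unfolded \<open>(\<Union>n. {y n<..}) = {a<..}\<close>]) auto
  qed
  have "measure D {b..} \<le> H (a + b - y n)" for n
    using y[of n] by (subst tail[symmetric]) (auto intro!: finite_measure_mono)
  then have "measure D {b..} \<le> H b"
    by (intro LIMSEQ_le_const[OF isCont_tendsto_compose[OF cont z_lim]]) auto
  then have b0: "measure D {b..} = 0"
    using H(2) measure_nonneg[of D "{b..}"] by simp
  have meas: "measure D {x<..<b} = H x" if "x \<in> {a..<b}" for x
  proof -
    have "measure D {x<..} = measure D {x<..<b} + measure D {b..}"
      using that by (subst finite_measure_Union[symmetric]) (auto intro!: arg_cong[where f = "measure D"])
    then show ?thesis using tail[of x] tail_a that b0 by (cases "x = a") auto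
  qed
  have integ: "(\<integral>\<^sup>+u. ennreal (f u) * indicator {x<..<b} u \<partial>lborel) = ennreal (H x)"
    if "x \<in> {a..<b}" for x
  proof -
    have "(\<integral>\<^sup>+u. ennreal (f u) * indicator {x<..<b} u \<partial>lborel)
        = (\<integral>\<^sup>+u. ennreal (f u) * indicator {x..b} u \<partial>lborel)"
      using AE_lborel_singleton[of x] AE_lborel_singleton[of b]
      by (intro nn_integral_cong_AE) (auto elim!: eventually_elim2 simp: indicator_def)
    also have "\<dots> = ennreal (- H b - - H x)"
      by (rule nn_integral_FTC_Icc)
         (use that f(2) in \<open>auto intro!: derivative_eq_intros H(1)[THEN has_field_derivative_at_within]\<close>)
    finally show ?thesis using H(2) by simp
  qed
  let ?S = "{a<..<b}"
  \<comment> \<open>The two restrictions are extended by zero to the whole line, where comparing the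
    rays \<open>{x<..}\<close> suffices.\<close>
  let ?D = "density D (indicator ?S)" and ?L = "density lborel (\<lambda>u. ennreal (f u) * indicator ?S u)"
  have eq: "?D = ?L"
  proof (rule measure_eqI_lessThan)
    fix x
    have 1: "emeasure ?D {x<..} = emeasure D ({x<..} \<inter> ?S)"
      by (subst emeasure_density) (auto simp: Int_commute simp flip: indicator_inter_arith)
    have 2: "emeasure ?L {x<..} = (\<integral>\<^sup>+u. ennreal (f u) * indicator ({x<..} \<inter> ?S) u \<partial>lborel)"
      by (subst emeasure_density) (auto simp: indicator_inter_arith mult_ac)
    show "emeasure ?D {x<..} < \<infinity>"
      unfolding 1 by (simp add: emeasure_eq_measure)
    show "emeasure ?D {x<..} = emeasure ?L {x<..}"
    proof (cases "x < b")
      case True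
      then have "{x<..} \<inter> ?S = {max a x<..<b}" by auto
      then show ?thesis
        unfolding 1 2 using True ab by (simp add: integ meas emeasure_eq_measure)
    next
      case False
      then have "{x<..} \<inter> ?S = {}" by auto
      then show ?thesis unfolding 1 2 by simp
    qed
  qed auto
  show "restrict_space D ?S = density (restrict_space lborel ?S) (\<lambda>x. ennreal (f x))"
  proof (rule measure_eqI)
    show "sets (restrict_space D ?S) = sets (density (restrict_space lborel ?S) (\<lambda>x. ennreal (f x)))"
      by (simp add: sets_restrict_space)
    fix A assume "A \<in> sets (restrict_space D ?S)"
    then have A: "A \<in> sets borel" "A \<subseteq> ?S"
      by (auto simp: sets_restrict_space)
    have "emeasure (restrict_space D ?S) A = emeasure ?D A"
      using A by (subst emeasure_restrict_space, simp_all, subst emeasure_density)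
        (auto simp: Int_absorb1 simp flip: indicator_inter_arith)
    also have "\<dots> = (\<integral>\<^sup>+u. ennreal (f u) * indicator ?S u * indicator A u \<partial>lborel)"
      unfolding eq using A by (subst emeasure_density) auto
    also have "\<dots> = (\<integral>\<^sup>+u. ennreal (f u) * indicator A u * indicator ?S u \<partial>lborel)"
      by (simp add: mult_ac)
    also have "\<dots> = (\<integral>\<^sup>+u. ennreal (f u) * indicator A u \<partial>restrict_space lborel ?S)"
      by (subst nn_integral_restrict_space) auto
    also have "\<dots> = emeasure (density (restrict_space lborel ?S) (\<lambda>x. ennreal (f x))) A"
      using A by (subst emeasure_density) (auto simp: sets_restrict_space_iff intro: measurable_restrict_space1)
    finally show "emeasure (restrict_space D ?S) A
        = emeasure (density (restrict_space lborel ?S) (\<lambda>x. ennreal (f x))) A" .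
  qed
qed

lemma has_real_derivative_max_tail:
  "(max_tail (2 * k + 1) has_real_derivative
      real (2 * k + 1) * real ((2 * k) choose k) * (p * (1 - p)) ^ k
    + real (2 * k + 1) * real ((2 * k) choose (k + 1)) * p ^ (k + 1) * (1 - p) ^ (k - 1)) (at p)"
proof -
  have d: "Suc ((2 * k + 1) div 2) = k + 1" "Suc (Suc (2 * k + 1) div 2) = k + 1 + 1" by simp_all
  have m: "max_tail (2 * k + 1) = (\<lambda>p.
      (\<Sum>i=k+1..2 * k + 1. real (2 * k + 1 choose i) * p ^ i * (1 - p) ^ (2 * k + 1 - i))
    + (\<Sum>i=k+1+1..2 * k + 1. real (2 * k + 1 choose i) * p ^ i * (1 - p) ^ (2 * k + 1 - i)))"
    by (rule ext) (simp only: max_tail_def d)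
  \<comment> \<open>For \<open>k = 0\<close> the second equation holds by truncated subtraction, and
    the coefficient \<open>(2 * k) choose (k + 1)\<close> is then 0.\<close>
  have e: "2 * k - k = k" "2 * k - (k + 1) = k - 1" by auto
  note D = has_real_derivative_binomial_tail[where m = "2 * k", unfolded Suc_eq_plus1]
  show ?thesis
    unfolding m using DERIV_add[OF D[of k p] D[of "k + 1" p]]
    unfolding e power_mult_distrib mult.assoc .
qed

text \<open>The factor \<open>1 / (2 * x)\<close> is minus the derivative of \<open>p\<close> in
  \<open>\<beta>\<close>. For positive \<open>k\<close> the summands do not match one by one; the
  sums agree after reduction to a common denominator.\<close>

lemma max_density_eq:
  fixes x \<beta> :: real
  assumes "x > 0"
  defines "p \<equiv> (1 - \<beta> / x) / 2"
  shows "(real (2 * k + 1) * real ((2 * k) choose k) * (p * (1 - p)) ^ k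
     + real (2 * k + 1) * real ((2 * k) choose (k + 1)) * p ^ (k + 1) * (1 - p) ^ (k - 1)) / (2 * x)
   = (if k = 0 then 0
      else fact (2 * k + 1) / (fact (k - 1) * fact (k + 1))
         * ((x\<^sup>2 - \<beta>\<^sup>2) ^ (k - 1) * (x - \<beta>) / (2 * x) ^ (2 * k)))
     + fact (2 * k + 1) / (fact k * fact (k + 1)) * ((x\<^sup>2 - \<beta>\<^sup>2) ^ k / (2 * x) ^ (2 * k + 1))"
proof (cases k)
  case 0
  then show ?thesis by simp
next
  case (Suc l)
  define y where "y = 2 * x"
  have y: "y \<noteq> 0" using assms by (simp add: y_def)
  have p: "p = (x - \<beta>) / y" "1 - p = (x + \<beta>) / y"
    using assms by (simp_all add: p_def y_def field_simps)
  define W where "W = (x\<^sup>2 - \<beta>\<^sup>2) ^ l"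
  define F :: real where "F = fact (2 * k + 1)"
  have prod: "(x - \<beta>) * (x + \<beta>) = x\<^sup>2 - \<beta>\<^sup>2" by (simp add: power2_eq_square algebra_simps)
  have pq: "p * (1 - p) = (x\<^sup>2 - \<beta>\<^sup>2) / y\<^sup>2"
    unfolding p(2) unfolding p(1) by (simp add: prod power2_eq_square)
  have 1: "(p * (1 - p)) ^ k = W * (x\<^sup>2 - \<beta>\<^sup>2) / y ^ (2 * k)"
    unfolding pq W_def Suc by (simp add: power_divide power_mult power_mult_distrib power2_eq_square mult_ac)
  have "p ^ (k + 1) * (1 - p) ^ (k - 1) = (p * (1 - p)) ^ l * p\<^sup>2"
    unfolding Suc by (simp add: power_mult_distrib power2_eq_square)
  also have "\<dots> = W * (x - \<beta>)\<^sup>2 / y ^ (2 * k)"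
    unfolding pq W_def unfolding p(1) Suc by (simp add: power_divide power2_eq_square power_mult power_mult_distrib mult_ac)
  finally have 2: "p ^ (k + 1) * (1 - p) ^ (k - 1) = W * (x - \<beta>)\<^sup>2 / y ^ (2 * k)" .
  have "real ((2 * k) choose k) = fact (2 * k) / (fact k * fact k)"
    by (subst binomial_fact) (auto simp: mult_2)
  then have 3: "real (2 * k + 1) * real ((2 * k) choose k) = F / (fact k * fact k)"
    by (simp add: F_def)
  have k: "k + 1 \<le> 2 * k" "2 * k - (k + 1) = k - 1" using Suc by simp_all
  have "real ((2 * k) choose (k + 1)) = fact (2 * k) / (fact (k + 1) * fact (k - 1))"
    unfolding binomial_fact[OF k(1)] k(2) ..
  then have 4: "real (2 * k + 1) * real ((2 * k) choose (k + 1)) = F / (fact (k + 1) * fact (k - 1))"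
    by (simp add: F_def)
  have f: "fact k = real k * fact l" "fact (k + 1) = (real k + 1) * (real k * fact l)" "k - 1 = l"
    using Suc by (simp_all add: add.commute)
  have nz: "real k \<noteq> 0" "real k + 1 \<noteq> 0" "(fact l :: real) \<noteq> 0" using Suc by simp_all
  \<comment> \<open>The identity between the numerators:
    \<open>(x\<^sup>2 - \<beta>\<^sup>2) + (x - \<beta>)\<^sup>2\<close> factors as
    \<open>2 * x * (x - \<beta>)\<close>.\<close>
  have key: "(real k + 1) * (x\<^sup>2 - \<beta>\<^sup>2) + real k * (x - \<beta>)\<^sup>2 = real k * y * (x - \<beta>) + (x\<^sup>2 - \<beta>\<^sup>2)"
    by (simp add: y_def power2_eq_square algebra_simps)
  \<comment> \<open>Common denominators, with \<open>K\<close>, \<open>K1\<close> and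
    \<open>L\<close> standing for \<open>k\<close>, \<open>k + 1\<close> and the factorial of
    \<open>k - 1\<close>.\<close>
  have *: "(F / (K * L * (K * L)) * (W * G / Y) + F / (K1 * (K * L) * L) * (W * S / Y)) / y
      = F * W * (K1 * G + K * S) / (K * K * K1 * L * L * Y * y)"
    if "K \<noteq> 0" "K1 \<noteq> 0" "L \<noteq> 0" "Y \<noteq> 0" for K K1 L Y G S :: real
    using that y by (simp add: field_simps)
  have **: "F / (L * (K1 * (K * L))) * (W * u / Y) + F / (K * L * (K1 * (K * L))) * (W * G / (Y * y))
      = F * W * (K * y * u + G) / (K * K * K1 * L * L * Y * y)"
    if "K \<noteq> 0" "K1 \<noteq> 0" "L \<noteq> 0" "Y \<noteq> 0" for K K1 L Y G u :: real
    using that y by (simp add: field_simps)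
  have Y: "y ^ (2 * k) \<noteq> 0" "y ^ (2 * k + 1) = y ^ (2 * k) * y" using y by simp_all
  have "(real (2 * k + 1) * real ((2 * k) choose k) * (p * (1 - p)) ^ k
     + real (2 * k + 1) * real ((2 * k) choose (k + 1)) * p ^ (k + 1) * (1 - p) ^ (k - 1)) / y
    = (F / (fact k * fact k) * (W * (x\<^sup>2 - \<beta>\<^sup>2) / y ^ (2 * k))
       + F / (fact (k + 1) * fact (k - 1)) * (W * (x - \<beta>)\<^sup>2 / y ^ (2 * k))) / y"
    by (simp only: 1 3 4 mult.assoc 2[symmetric])
  also have "\<dots> = F / (fact (k - 1) * fact (k + 1)) * (W * (x - \<beta>) / y ^ (2 * k))
     + F / (fact k * fact (k + 1)) * (W * (x\<^sup>2 - \<beta>\<^sup>2) / y ^ (2 * k + 1))"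
    unfolding f Y(2) *[OF nz Y(1)] **[OF nz Y(1)] key ..
  finally have eq: "(real (2 * k + 1) * real ((2 * k) choose k) * (p * (1 - p)) ^ k
     + real (2 * k + 1) * real ((2 * k) choose (k + 1)) * p ^ (k + 1) * (1 - p) ^ (k - 1)) / y
    = F / (fact (k - 1) * fact (k + 1)) * (W * (x - \<beta>) / y ^ (2 * k))
     + F / (fact k * fact (k + 1)) * (W * (x\<^sup>2 - \<beta>\<^sup>2) / y ^ (2 * k + 1))" .
  have w: "W * (x\<^sup>2 - \<beta>\<^sup>2) = (x\<^sup>2 - \<beta>\<^sup>2) ^ k" "W = (x\<^sup>2 - \<beta>\<^sup>2) ^ (k - 1)"
    and k0: "(k = 0) = False"
    by (simp_all add: W_def Suc)
  show ?thesis
    unfolding k0 if_False using eq unfolding w(1) F_def y_def unfolding w(2) .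
qed

theorem theorem4p2:
  fixes M :: "'a measure" and rate c t :: real
    and N :: "real \<Rightarrow> 'a \<Rightarrow> nat" and V0 :: "'a \<Rightarrow> real" and k :: nat
  assumes "symmetric_telegraph M rate N c V0"
    and "t > 0"
  shows "cond_density_on M {\<omega> \<in> space M. V0 \<omega> = - c \<and> N t \<omega> = 2 * k + 1}
           (running_max (telegraph V0 N) t) {0<..<c * t}
           (\<lambda>\<beta>. (if k = 0 then 0
                 else fact (2 * k + 1) / (fact (k - 1) * fact (k + 1))
                      * ((c\<^sup>2 * t\<^sup>2 - \<beta>\<^sup>2) ^ (k - 1) * (c * t - \<beta>) / (2 * c * t) ^ (2 * k)))
               + fact (2 * k + 1) / (fact k * fact (k + 1))
                      * ((c\<^sup>2 * t\<^sup>2 - \<beta>\<^sup>2) ^ k / (2 * c * t) ^ (2 * k + 1)))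
       \<and> \<P>(\<omega> in M. running_max (telegraph V0 N) t \<omega> = 0 \<bar> V0 \<omega> = - c \<and> N t \<omega> = 2 * k + 1)
           = real ((2 * k + 1) choose k) * (1 / 2 ^ (2 * k + 1))"
proof -
  interpret symmetric_telegraph M rate N c V0 by fact
  let ?n = "2 * k + 1"
  define A where "A = {\<omega> \<in> space M. V0 \<omega> = - c \<and> N t \<omega> = ?n}"
  define X where "X = running_max (telegraph V0 N) t"
  define f where "f = (\<lambda>\<beta>. (if k = 0 then 0
                 else fact (2 * k + 1) / (fact (k - 1) * fact (k + 1))
                      * ((c\<^sup>2 * t\<^sup>2 - \<beta>\<^sup>2) ^ (k - 1) * (c * t - \<beta>) / (2 * c * t) ^ (2 * k)))
               + fact (2 * k + 1) / (fact k * fact (k + 1))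
                      * ((c\<^sup>2 * t\<^sup>2 - \<beta>\<^sup>2) ^ k / (2 * c * t) ^ (2 * k + 1)))"
  \<comment> \<open>The tail of the conditional law; \<open>\<beta> = 0\<close> corresponds to
    \<open>p = 1 / 2\<close> and \<open>\<beta> = c * t\<close> to \<open>p = 0\<close>.\<close>
  define H where "H \<beta> = max_tail ?n ((1 - \<beta> / (c * t)) / 2)" for \<beta>
  have ct: "0 < c * t" using assms(2) speed_pos by simp
  have A: "A \<in> events" "prob A = exp (- rate * t) * (rate * t) ^ ?n / fact ?n / 2"
    unfolding A_def by (rule prob_neg_count[OF assms(2)])+
  have A_pos: "prob A > 0"
    unfolding A(2) using assms(2) rate_pos by simp
  have [measurable]: "X \<in> borel_measurable M"
    unfolding X_def using assms(2) by simp
  have f_nonneg: "0 \<le> f \<beta>" if "\<beta> \<in> {0..c * t}" for \<beta>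
  proof -
    have "\<beta>\<^sup>2 \<le> (c * t)\<^sup>2" using that by (intro power_mono) auto
    then have "0 \<le> c\<^sup>2 * t\<^sup>2 - \<beta>\<^sup>2" by (simp add: power_mult_distrib)
    moreover have "0 \<le> 2 * c * t" using ct by simp
    ultimately show ?thesis
      unfolding f_def using that by (auto intro!: add_nonneg_nonneg mult_nonneg_nonneg divide_nonneg_nonneg)
  qed
  have H_deriv: "(H has_real_derivative - f \<beta>) (at \<beta>)" for \<beta>
  proof -
    define p where "p = (1 - \<beta> / (c * t)) / 2"
    have "((\<lambda>\<beta>. (1 - \<beta> / (c * t)) / 2) has_real_derivative - (1 / (2 * (c * t)))) (at \<beta>)"
      using ct by (auto intro!: derivative_eq_intros)
    from DERIV_chain2[OF has_real_derivative_max_tail this, of k]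
    have "(H has_real_derivative - ((real (2 * k + 1) * real ((2 * k) choose k) * (p * (1 - p)) ^ k
     + real (2 * k + 1) * real ((2 * k) choose (k + 1)) * p ^ (k + 1) * (1 - p) ^ (k - 1)) / (2 * (c * t)))) (at \<beta>)"
      unfolding H_def p_def by (simp only: mult_minus_right times_divide_eq_right mult_1_right)
    then show ?thesis
      unfolding p_def max_density_eq[OF ct] f_def by (simp only: power_mult_distrib mult.assoc)
  qed
  have H_ct: "H (c * t) = 0"
  proof -
    have "c * t / (c * t) = 1" using ct by (intro divide_self) auto
    then show ?thesis by (simp only: H_def) (simp add: max_tail_zero)
  qed
  define D where "D = distr (uniform_measure M A) borel X"
  have emA: "emeasure M A \<noteq> 0" "emeasure M A \<noteq> \<infinity>"
    using A_pos by (auto simp: emeasure_eq_measure)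
  interpret D: prob_space D
    unfolding D_def using prob_space_uniform_measure[OF emA] by (rule prob_space.prob_space_distr) simp
  have D: "measure D B = prob (A \<inter> X -` B) / prob A" if "B \<in> sets borel" for B
  proof -
    have "measure D B = measure (uniform_measure M A) (X -` B \<inter> space M)"
      unfolding D_def using that by (subst measure_distr) auto
    also have "\<dots> = prob (A \<inter> (X -` B \<inter> space M)) / prob A"
      using that by (intro measure_uniform_measure emA) auto
    also have "A \<inter> (X -` B \<inter> space M) = A \<inter> X -` B"
      by (auto simp: A_def)
    finally show ?thesis .
  qed
  have tail: "measure D {\<beta><..} = H \<beta>" if "\<beta> \<in> {0<..<c * t}" for \<beta>
  proof -
    have "A \<inter> X -` {\<beta><..} = {\<omega> \<in> space M. V0 \<omega> = - c \<and> N t \<omega> = ?n \<and> running_max (telegraph V0 N) t \<omega> > \<beta>}"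
      by (auto simp: A_def X_def)
    then have "prob (A \<inter> X -` {\<beta><..}) = prob A * H \<beta>"
      using prob_running_max_gt[OF assms(2), of \<beta> ?n] that unfolding A(2) H_def by simp
    then show ?thesis using A_pos by (simp add: D)
  qed
  have f_meas [measurable]: "f \<in> borel_measurable borel"
    unfolding f_def by measurable
  have finD: "finite_measure D" by unfold_locales
  have setsD: "sets D = sets borel" by (simp add: D_def)
  note density = restrict_space_eq_density[OF finD setsD ct f_meas f_nonneg H_deriv H_ct tail]
  have "cond_density_on M A X {0<..<c * t} f"
    unfolding cond_density_on_def
    using A(1) emA f_nonneg density(1)[unfolded D_def]
    by (auto intro: measurable_restrict_space1)
  moreover have "cond_prob M (\<lambda>\<omega>. X \<omega> = 0) (\<lambda>\<omega>. V0 \<omega> = - c \<and> N t \<omega> = ?n)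
      = real (?n choose k) * (1 / 2 ^ ?n)"
  proof -
    \<comment> \<open>The path starts at 0, so the maximum is nonnegative and the atom at 0 is the
      complement of the positive half-line, with mass \<open>1 - H 0\<close>.\<close>
    have "X \<omega> \<ge> 0" if "\<omega> \<in> space M" for \<omega>
      using telegraph_le_running_max[OF that, of 0 t] assms(2) by (simp add: X_def telegraph_def)
    then have "{\<omega> \<in> space M. X \<omega> = 0 \<and> V0 \<omega> = - c \<and> N t \<omega> = ?n} = A \<inter> X -` (- {0<..})"
      by (force simp: A_def)
    then have "cond_prob M (\<lambda>\<omega>. X \<omega> = 0) (\<lambda>\<omega>. V0 \<omega> = - c \<and> N t \<omega> = ?n) = measure D (- {0<..})"
      unfolding cond_prob_def A_def[symmetric] by (simp add: D)
    also have "\<dots> = measure D (space D - {0<..})"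
      by (simp add: D_def Compl_eq_Diff_UNIV)
    also have "\<dots> = 1 - H 0"
      using density(2) by (subst D.prob_compl) (auto simp: setsD)
    also have "H 0 = 1 - real (?n choose k) * (1 / 2 ^ ?n)"
      unfolding H_def using max_tail_half[of k] by simp
    finally show ?thesis by simp
  qed
  ultimately show ?thesis
    unfolding A_def X_def f_def by blast
qed

end
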